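(* Let $G$ be a non-discrete LCA group with dual $\Gamma$ and $V$ an open neighbourhood of $0\in\Gamma$ with compact closure $\bar V$. (i) Let $0\ne\mu\in M_0(G)$. For every $\varepsilon>0$ there exists a compact set $\Omega_\varepsilon\subseteq\Gamma$ with dense nonempty interior such that $\sup_{\gamma\in\Gamma\setminus\Omega_\varepsilon}\|\hat\mu\|^{\bar V,\gamma}\le\varepsilon$. (ii) $M_0(G)=\mathcal L^1_{\bar V}(G)\cap M(G)$.
   Context: $G$ non-discrete LCA with dual $\Gamma$, $(x,\gamma)=\gamma(x)$, Haar measures normalized for Fourier inversion; $M(G)$ the measure algebra with total variation norm, $L^1(G)\subset M(G)$, $\hat\mu(\gamma)=\int_G(-x,\gamma)d\mu(x)$. $M_0(G)$ (Rajchman measures) is the set of $\mu\in M(G)$ with $\hat\mu\in C_0(\Gamma)$. For $E\subseteq\Gamma$, $\mathrm{span}(E)$ is the span of the characters in $E$ as functions on $G$, each $p$ uniquely $\sum\hat p(\gamma)\gamma$, $\|p\|_\infty=\sup_G|p|$. For $\phi\in C_b(\Gamma)$: $\|\phi\|^{\bar V,\gamma}=\sup\{|\sum_{\gamma'\in\bar V+\gamma}\hat p(\gamma')\phi(\gamma')|:p\in\mathrm{span}(\bar V+\gamma),\|p\|_\infty\le1\}$, $\|\phi\|^{\bar V}=\sup_\gamma\|\phi\|^{\bar V,\gamma}$. For $\mu\in M(G)$, $\|\mu\|_{\bar V}=\|\hat\mu\|^{\bar V}$, an algebra norm dominated by $\|\mu\|$. $\mathcal M_{\bar V}(G)$ is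 the completion of $(M(G),\|\cdot\|_{\bar V})$ (so $M(G)\subseteq\mathcal M_{\bar V}(G)$) and $\mathcal L^1_{\bar V}(G)$ is the closure of $L^1(G)$ in $\mathcal M_{\bar V}(G)$. *)

theory Defs
  imports "HOL-Analysis.Analysis"
begin

definition characters :: "('g::topological_ab_group_add \<Rightarrow> complex) set" where
  "characters = {\<gamma>. continuous_on UNIV \<gamma> \<and> (\<forall>x. cmod (\<gamma> x) = 1) \<and>
                      (\<forall>x y. \<gamma> (x + y) = \<gamma> x * \<gamma> y)}"

definition dual_top :: "('g::topological_ab_group_add \<Rightarrow> complex) topology" where
  "dual_top = topology_generated_by
     {{\<gamma> \<in> characters. \<forall>x\<in>K. cmod (\<gamma> x - \<gamma>0 x) < e} | K \<gamma>0 e.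
        compact K \<and> \<gamma>0 \<in> characters \<and> e > 0}"

text \<open>Group operation of the dual (written additively in the paper): pointwise product.
  The neutral element is the trivial character.\<close>
definition dual_translate :: "('g \<Rightarrow> complex) set \<Rightarrow> ('g \<Rightarrow> complex) \<Rightarrow> ('g \<Rightarrow> complex) set" where
  "dual_translate E \<gamma> = (\<lambda>\<gamma>'. (\<lambda>x. \<gamma>' x * \<gamma> x)) ` E"

text \<open>The norm \<open>\<parallel>\<phi>\<parallel>^{E}\<close> relative to E = Vbar + \<gamma>: supremum of
  \<open>|\<Sum> p^(\<gamma>') \<phi>(\<gamma>')|\<close> over trigonometric polynomials p with spectrum in E and
  sup-norm at most 1. A polynomial is given by a finite set S \<subseteq> E and coefficients c
  (characters are linearly independent, so c are exactly the Fourier coefficients).\<close>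
definition loc_norm :: "('g \<Rightarrow> complex) set \<Rightarrow> (('g \<Rightarrow> complex) \<Rightarrow> complex) \<Rightarrow> real" where
  "loc_norm E \<phi> = Sup {cmod (\<Sum>s\<in>S. c s * \<phi> s) | S c.
       finite S \<and> S \<subseteq> E \<and> (\<forall>x. cmod (\<Sum>s\<in>S. c s * s x) \<le> 1)}"

definition Vnorm_at :: "('g::topological_ab_group_add \<Rightarrow> complex) set \<Rightarrow> (('g \<Rightarrow> complex) \<Rightarrow> complex)
      \<Rightarrow> ('g \<Rightarrow> complex) \<Rightarrow> real" where
  "Vnorm_at Vb \<phi> \<gamma> = loc_norm (dual_translate Vb \<gamma>) \<phi>"

definition Vnorm :: "('g::topological_ab_group_add \<Rightarrow> complex) set \<Rightarrow> (('g \<Rightarrow> complex) \<Rightarrow> complex) \<Rightarrow> real" where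
  "Vnorm Vb \<phi> = (SUP \<gamma>\<in>characters. Vnorm_at Vb \<phi> \<gamma>)"

definition finite_radon :: "'g::topological_space measure \<Rightarrow> bool" where
  "finite_radon \<nu> \<longleftrightarrow> sets \<nu> = sets borel \<and> finite_measure \<nu> \<and>
     (\<forall>A\<in>sets borel. emeasure \<nu> A = (SUP K\<in>{K. K \<subseteq> A \<and> compact K}. emeasure \<nu> K))"

definition haar_measure :: "'g::topological_ab_group_add measure \<Rightarrow> bool" where
  "haar_measure H \<longleftrightarrow> sets H = sets borel \<and>
     (\<forall>K. compact K \<longrightarrow> emeasure H K < \<infinity>) \<and>
     (\<forall>U. open U \<and> U \<noteq> {} \<longrightarrow> emeasure H U > 0) \<and>
     (\<forall>A\<in>sets borel. emeasure H A = (INF U\<in>{U. A \<subseteq> U \<and> open U}. emeasure H U)) \<and>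
     (\<forall>U. open U \<longrightarrow> emeasure H U = (SUP K\<in>{K. K \<subseteq> U \<and> compact K}. emeasure H K)) \<and>
     (\<forall>a. \<forall>A\<in>sets borel. emeasure H ((+) a ` A) = emeasure H A)"

text \<open>A complex measure \<mu> \<in> M(G) is represented as \<open>h d\<nu>\<close> with \<nu> a finite Radon
  measure and h \<in> L^1(\<nu>) (polar decomposition: every element of M(G) arises this way).
  Fourier--Stieltjes transform: \<open>\<mu>^(\<gamma>) = \<integral> (-x,\<gamma>) d\<mu>(x)\<close>.\<close>
definition fourier_meas :: "'g::topological_ab_group_add measure \<Rightarrow> ('g \<Rightarrow> complex)
      \<Rightarrow> ('g \<Rightarrow> complex) \<Rightarrow> complex" where
  "fourier_meas \<nu> h \<gamma> = (\<integral>x. \<gamma> (- x) * h x \<partial>\<nu>)"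

definition in_M :: "'g::topological_ab_group_add measure \<Rightarrow> ('g \<Rightarrow> complex) \<Rightarrow> bool" where
  "in_M \<nu> h \<longleftrightarrow> finite_radon \<nu> \<and> integrable \<nu> h"

definition C0_dual :: "(('g::topological_ab_group_add \<Rightarrow> complex) \<Rightarrow> complex) \<Rightarrow> bool" where
  "C0_dual \<phi> \<longleftrightarrow> continuous_map dual_top euclidean \<phi> \<and>
     (\<forall>e>0. \<exists>K. compactin dual_top K \<and> (\<forall>\<gamma>\<in>characters - K. cmod (\<phi> \<gamma>) < e))"


end

(* Trigonometric polynomials with spectrum in a compact set and sup-norm at most 1 are
   equicontinuous (a Bernstein-type inequality), hence precompact on compact sets. Multiplying by a
   character gamma moves the spectrum to Vbar + gamma, so up to epsilon only finitely many
   polynomials have to be tested against a measure mu, each giving a finite combination of values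
   of the transform of mu near gamma; this yields (i). For (ii), mu is approximated by k * mu with k
   the normalised indicator of a small neighbourhood of 0: far out in the dual both transforms are
   locally small by (i), and on a compact part of the dual smoothing hardly changes a polynomial, by
   equicontinuity. Conversely, the V-norm dominates the sup-norm of the transform, so the
   Riemann-Lebesgue lemma applies. *)

theory Submission
  imports Defs
begin


section \<open>The Bernstein inequality on an abelian group\<close>

text \<open>An abstract group offers no derivative, so the Bernstein-type inequality is stated for
  differences and proved by an algebra of Fourier multipliers. Translations have norm 1, and bounds
  pass through sums, products and pointwise limits. The half-angle formula halves the bound of a
  second difference in passing from \<open>x + x\<close> to \<open>x\<close>; a Landau-type
  interpolation then gives first differences of order d^(1/2) when the characters of the spectrum
  are within d of 1 at \<open>x\<close>. The true order is d, but only equicontinuity matters.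
  Twisting a measure by \<open>\<gamma>\<close> leaves its total variation unchanged, so one compact
  set and one finite net serve all \<open>\<gamma>\<close> at once. In (ii) the measure is
  discretised. The oscillation of k * P is controlled by the L^1 translation modulus of k, whatever
  the spectrum of P, so point masses replace the measure uniformly over all P in the unit ball.
  Riemann-Lebesgue rests on compactness in the dual: if the transform of an indicator is at least e
  at \<open>\<gamma>\<close>, then \<open>\<gamma> t - 1\<close> is dominated by that modulus at t
  divided by e, and such characters form a compact set.\<close>

text \<open>A bound for the operator norm of the Fourier multiplier \<open>v\<close> on polynomials
  with frequencies in \<open>S\<close>, for the sup norm. The free \<open>M\<close> replaces a
  supremum, so that composing multipliers is just composing implications.\<close>

definition multiplier_bound :: "('g::ab_group_add \<Rightarrow> complex) set \<Rightarrow> (('g \<Rightarrow> complex) \<Rightarrow> complex) \<Rightarrow> real \<Rightarrow> bool" where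
  "multiplier_bound S v B \<longleftrightarrow> (\<forall>c M. (\<forall>y. cmod (\<Sum>s\<in>S. c s * s y) \<le> M) \<longrightarrow>
      (\<forall>y. cmod (\<Sum>s\<in>S. c s * v s * s y) \<le> B * M))"

lemma multiplier_boundD:
  assumes "multiplier_bound S v B" "\<And>y. cmod (\<Sum>s\<in>S. c s * s y) \<le> M"
  shows "cmod (\<Sum>s\<in>S. c s * v s * s y) \<le> B * M"
  using assms unfolding multiplier_bound_def by blast

lemma multiplier_bound_cong:
  assumes "multiplier_bound S v B" "\<And>s. s \<in> S \<Longrightarrow> v s = w s"
  shows "multiplier_bound S w B"
proof -
  have "(\<Sum>s\<in>S. c s * v s * s y) = (\<Sum>s\<in>S. c s * w s * s y)" for c y
    by (rule sum.cong) (auto simp: assms(2))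
  with assms(1) show ?thesis by (simp add: multiplier_bound_def)
qed

lemma multiplier_bound_mono:
  assumes "multiplier_bound S v B" "B \<le> C"
  shows "multiplier_bound S v C"
  unfolding multiplier_bound_def
proof (intro allI impI)
  fix c M y assume M: "\<forall>y. cmod (\<Sum>s\<in>S. c s * s y) \<le> M"
  then have "0 \<le> M" by (meson norm_ge_zero order_trans)
  have "cmod (\<Sum>s\<in>S. c s * v s * s y) \<le> B * M"
    using M by (intro multiplier_boundD[OF assms(1)]) auto
  also have "\<dots> \<le> C * M" by (rule mult_right_mono) fact+
  finally show "cmod (\<Sum>s\<in>S. c s * v s * s y) \<le> C * M" .
qed

lemma multiplier_bound_mult:
  assumes v: "multiplier_bound S v B" and w: "multiplier_bound S w C"
  shows "multiplier_bound S (\<lambda>s. v s * w s) (B * C)"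
  unfolding multiplier_bound_def
proof (intro allI impI)
  fix c M y assume M: "\<forall>y. cmod (\<Sum>s\<in>S. c s * s y) \<le> M"
  have "cmod (\<Sum>s\<in>S. (c s * w s) * s y) \<le> C * M" for y
    using M by (intro multiplier_boundD[OF w]) auto
  from multiplier_boundD[OF v this, of y]
  show "cmod (\<Sum>s\<in>S. c s * (v s * w s) * s y) \<le> B * C * M"
    by (simp add: mult_ac)
qed

lemma multiplier_bound_add:
  assumes v: "multiplier_bound S v B" and w: "multiplier_bound S w C"
  shows "multiplier_bound S (\<lambda>s. v s + w s) (B + C)"
  unfolding multiplier_bound_def
proof (intro allI impI)
  fix c M y assume M: "\<forall>y. cmod (\<Sum>s\<in>S. c s * s y) \<le> M"
  have "(\<Sum>s\<in>S. c s * (v s + w s) * s y) = (\<Sum>s\<in>S. c s * v s * s y) + (\<Sum>s\<in>S. c s * w s * s y)"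
    by (simp add: sum.distrib algebra_simps)
  moreover have "cmod (\<Sum>s\<in>S. c s * v s * s y) \<le> B * M"
    using M by (intro multiplier_boundD[OF v]) auto
  moreover have "cmod (\<Sum>s\<in>S. c s * w s * s y) \<le> C * M"
    using M by (intro multiplier_boundD[OF w]) auto
  ultimately show "cmod (\<Sum>s\<in>S. c s * (v s + w s) * s y) \<le> (B + C) * M"
    by (metis (no_types, lifting) add_mono distrib_right norm_triangle_le)
qed

lemma multiplier_bound_const: "multiplier_bound S (\<lambda>s. a) (cmod a)"
  unfolding multiplier_bound_def
proof (intro allI impI)
  fix c M y assume M: "\<forall>y. cmod (\<Sum>s\<in>S. c s * s y) \<le> M"
  have "(\<Sum>s\<in>S. c s * a * s y) = a * (\<Sum>s\<in>S. c s * s y)"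
    by (simp add: sum_distrib_left mult_ac)
  then show "cmod (\<Sum>s\<in>S. c s * a * s y) \<le> cmod a * M"
    using M by (simp add: norm_mult mult_left_mono)
qed

lemma multiplier_bound_scale:
  assumes "multiplier_bound S v B"
  shows "multiplier_bound S (\<lambda>s. a * v s) (cmod a * B)"
  using multiplier_bound_mult[OF multiplier_bound_const assms] .

text \<open>Multiplying each coefficient by \<open>s x\<close> translates the polynomial by
  \<open>x\<close>. Besides constants this is the only multiplier bounded directly; the others arise
  from it by algebra and limits.\<close>

lemma multiplier_bound_translate:
  assumes "\<And>s y. s \<in> S \<Longrightarrow> s (x + y) = s x * s y"
  shows "multiplier_bound S (\<lambda>s. s x) 1"
  unfolding multiplier_bound_def
proof (intro allI impI)
  fix c M y assume M: "\<forall>y. cmod (\<Sum>s\<in>S. c s * s y) \<le> M"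
  have "(\<Sum>s\<in>S. c s * s x * s y) = (\<Sum>s\<in>S. c s * s (x + y))"
    by (rule sum.cong) (auto simp: assms)
  then show "cmod (\<Sum>s\<in>S. c s * s x * s y) \<le> 1 * M"
    using M by simp
qed

lemma multiplier_bound_limit:
  assumes B: "\<And>k::nat. multiplier_bound S (v k) B"
    and lim: "\<And>s. s \<in> S \<Longrightarrow> (\<lambda>k. v k s) \<longlonglongrightarrow> w s"
  shows "multiplier_bound S w B"
  unfolding multiplier_bound_def
proof (intro allI impI)
  fix c M y assume M: "\<forall>y. cmod (\<Sum>s\<in>S. c s * s y) \<le> M"
  have "(\<lambda>k. cmod (\<Sum>s\<in>S. c s * v k s * s y)) \<longlonglongrightarrow> cmod (\<Sum>s\<in>S. c s * w s * s y)"
    by (intro tendsto_intros lim)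
  moreover have "\<forall>k. cmod (\<Sum>s\<in>S. c s * v k s * s y) \<le> B * M"
    using M by (intro allI multiplier_boundD[OF B]) auto
  ultimately show "cmod (\<Sum>s\<in>S. c s * w s * s y) \<le> B * M"
    using LIMSEQ_le_const2 by blast
qed

text \<open>The half-angle formula \<open>1 - Re (s x) = 1 - sqrt (1 - u)\<close> with \<open>u = half_dist (x + x) s\<close> halves
  multiplier bounds: \<open>1 - sqrt (1 - u)\<close> is the limit of the iteration \<open>w \<mapsto> (u + w\<^sup>2) / 2\<close>, under which
  every bound \<open>B \<le> 1\<close> for \<open>u\<close> persists.\<close>

primrec sqrt_iter :: "real \<Rightarrow> nat \<Rightarrow> real" where
  "sqrt_iter u 0 = 0"
| "sqrt_iter u (Suc k) = (u + (sqrt_iter u k)\<^sup>2) / 2"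

text \<open>The value \<open>1 - a\<close> is a fixed point of the iteration, and the error is
  multiplied in each step by half the sum of \<open>1 - a\<close> and the current iterate, hence by
  at most \<open>1 - a\<close>. Positivity of \<open>a\<close> makes this ratio less than 1.\<close>

lemma sqrt_iter_bounds:
  assumes "0 < a" "a \<le> 1"
  shows "0 \<le> sqrt_iter (1 - a\<^sup>2) k \<and> sqrt_iter (1 - a\<^sup>2) k \<le> 1 - a
    \<and> (1 - a) - sqrt_iter (1 - a\<^sup>2) k \<le> (1 - a) ^ k"
proof (induction k)
  case 0
  then show ?case using assms by auto
next
  case (Suc k)
  let ?w = "sqrt_iter (1 - a\<^sup>2) k"
  have w2: "?w\<^sup>2 \<le> (1 - a)\<^sup>2"
    using Suc by (intro power_mono) auto
  have a2: "a\<^sup>2 \<le> 1"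
    using assms by (simp add: power_le_one)
  have "(1 - a) - sqrt_iter (1 - a\<^sup>2) (Suc k) = ((1 - a) - ?w) * (((1 - a) + ?w) / 2)"
    by (simp add: power2_eq_square field_simps)
  also have "\<dots> \<le> (1 - a) ^ k * (1 - a)"
    using Suc assms by (intro mult_mono) auto
  finally have 1: "(1 - a) - sqrt_iter (1 - a\<^sup>2) (Suc k) \<le> (1 - a) ^ Suc k"
    by (simp add: mult.commute)
  have 2: "sqrt_iter (1 - a\<^sup>2) (Suc k) \<le> 1 - a"
    using w2 by (simp add: power2_eq_square field_simps)
  have 3: "0 \<le> sqrt_iter (1 - a\<^sup>2) (Suc k)"
    using a2 by simp
  from 1 2 3 show ?case by blast
qed

lemma sqrt_iter_tendsto:
  assumes "0 < a" "a \<le> 1"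
  shows "sqrt_iter (1 - a\<^sup>2) \<longlonglongrightarrow> 1 - a"
proof -
  have "(\<lambda>k. (1 - a) - sqrt_iter (1 - a\<^sup>2) k) \<longlonglongrightarrow> 0"
  proof (rule tendsto_sandwich[of "\<lambda>_. 0" _ _ "\<lambda>k. (1 - a) ^ k"])
    show "(\<lambda>k. (1 - a) ^ k) \<longlonglongrightarrow> 0"
      using assms by (intro LIMSEQ_realpow_zero) auto
  qed (use sqrt_iter_bounds[OF assms] in auto)
  from tendsto_diff[OF tendsto_const[of "1 - a"] this] show ?thesis by simp
qed

text \<open>One step turns the bound \<open>B\<close> into \<open>(B + B * B) / 2\<close>, which is
  at most \<open>B\<close> exactly because \<open>B\<close> lies in [0, 1]. The bound is thus
  independent of \<open>k\<close> and survives the limit.\<close>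

lemma multiplier_bound_sqrt_iter:
  assumes u: "multiplier_bound S (\<lambda>s. of_real (u s)) B" and B: "0 \<le> B" "B \<le> 1"
  shows "multiplier_bound S (\<lambda>s. of_real (sqrt_iter (u s) k)) B"
proof (induction k)
  case 0
  show ?case
    using multiplier_bound_mono[OF multiplier_bound_const[of S 0]] B by simp
next
  case (Suc k)
  have "multiplier_bound S (\<lambda>s. (1/2) * (of_real (u s) + of_real (sqrt_iter (u s) k) * of_real (sqrt_iter (u s) k)))
      (cmod (1/2) * (B + B * B))"
    by (intro multiplier_bound_scale multiplier_bound_add multiplier_bound_mult u Suc)
  then have "multiplier_bound S (\<lambda>s. of_real (sqrt_iter (u s) (Suc k))) (cmod (1/2) * (B + B * B))"
    by (rule multiplier_bound_cong) (simp add: power2_eq_square)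
  moreover have "cmod (1/2) * (B + B * B) \<le> B"
    using mult_right_mono[OF B(2) B(1)] by (simp add: norm_divide)
  ultimately show ?case by (rule multiplier_bound_mono)
qed

section \<open>Second and first differences at points where the spectrum is close to 1\<close>

text \<open>A character stripped of continuity: the difference bound is purely algebraic and
  involves no topology on the group.\<close>

definition unitary_hom :: "('g::ab_group_add \<Rightarrow> complex) \<Rightarrow> bool" where
  "unitary_hom s \<longleftrightarrow> (\<forall>x. cmod (s x) = 1) \<and> (\<forall>x y. s (x + y) = s x * s y)"

lemma unitary_hom_zero: "unitary_hom s \<Longrightarrow> s 0 = 1"
proof -
  assume s: "unitary_hom s"
  then have "s 0 = s 0 * s 0" unfolding unitary_hom_def by (metis add_0)
  moreover have "s 0 \<noteq> 0" using s unfolding unitary_hom_def by (metis norm_zero zero_neq_one)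
  ultimately show ?thesis by simp
qed

lemma unitary_hom_minus: "unitary_hom s \<Longrightarrow> s (- x) = cnj (s x)"
proof -
  assume s: "unitary_hom s"
  have "s (- x) * s x = 1"
    using s unitary_hom_zero[OF s] unfolding unitary_hom_def by (metis add.left_inverse)
  moreover have "cnj (s x) * s x = 1"
    using s unfolding unitary_hom_def
    by (metis complex_norm_square mult.commute of_real_1 power_one)
  moreover have "s x \<noteq> 0" using calculation(1) by auto
  ultimately show ?thesis by (metis mult_right_cancel)
qed

lemma unitary_hom_double: "unitary_hom s \<Longrightarrow> Re (s (x + x)) = 2 * (Re (s x))\<^sup>2 - 1"
proof -
  assume s: "unitary_hom s"
  then have "(Re (s x))\<^sup>2 + (Im (s x))\<^sup>2 = 1"
    unfolding unitary_hom_def by (metis cmod_power2 power_one)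
  moreover have "s (x + x) = s x * s x" using s unfolding unitary_hom_def by blast
  ultimately show ?thesis by (simp add: power2_eq_square)
qed

definition half_dist :: "'g \<Rightarrow> ('g::ab_group_add \<Rightarrow> complex) \<Rightarrow> real" where
  "half_dist x s = (1 - Re (s x)) / 2"

lemma multiplier_bound_half_dist:
  assumes "\<And>s. s \<in> S \<Longrightarrow> unitary_hom s"
  shows "multiplier_bound S (\<lambda>s. of_real (half_dist x s)) 1"
proof -
  have t: "multiplier_bound S (\<lambda>s. s x) 1" for x
    by (rule multiplier_bound_translate) (use assms in \<open>auto simp: unitary_hom_def\<close>)
  have "multiplier_bound S (\<lambda>s. 1/2 + ((- 1/4) * s x + (- 1/4) * s (- x)))
     (cmod (1/2) + (cmod (- 1/4) * 1 + cmod (- 1/4) * 1))"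
    by (intro multiplier_bound_add multiplier_bound_scale multiplier_bound_const t)
  then have "multiplier_bound S (\<lambda>s. of_real (half_dist x s)) (cmod (1/2) + (cmod (- 1/4) * 1 + cmod (- 1/4) * 1))"
    by (rule multiplier_bound_cong)
       (auto simp: half_dist_def unitary_hom_minus[OF assms] complex_eq_iff)
  then show ?thesis by (simp add: norm_divide)
qed

text \<open>With \<open>s x\<close> = exp(i t), the multiplier at \<open>x + x\<close> is sin^2 t,
  and 1 - sqrt(1 - sin^2 t) = 1 - cos t is twice the multiplier at \<open>x\<close>. Positivity of
  \<open>Re (s x)\<close> selects the branch of the root.\<close>

lemma multiplier_bound_halve:
  assumes S: "\<And>s. s \<in> S \<Longrightarrow> unitary_hom s" and pos: "\<And>s. s \<in> S \<Longrightarrow> 0 < Re (s x)"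
    and B: "multiplier_bound S (\<lambda>s. of_real (half_dist (x + x) s)) B" "0 \<le> B" "B \<le> 1"
  shows "multiplier_bound S (\<lambda>s. of_real (half_dist x s)) (B / 2)"
proof -
  have "multiplier_bound S (\<lambda>s. complex_of_real (1 - Re (s x))) B"
  proof (rule multiplier_bound_limit)
    show "multiplier_bound S (\<lambda>s. of_real (sqrt_iter (half_dist (x + x) s) k)) B" for k
      by (rule multiplier_bound_sqrt_iter[OF B])
    fix s assume s: "s \<in> S"
    have "half_dist (x + x) s = 1 - (Re (s x))\<^sup>2"
      unfolding half_dist_def using unitary_hom_double[OF S[OF s]] by (simp add: field_simps)
    moreover have "Re (s x) \<le> 1"
      using S[OF s] unfolding unitary_hom_def by (metis complex_Re_le_cmod)
    ultimately show "(\<lambda>k. complex_of_real (sqrt_iter (half_dist (x + x) s) k)) \<longlonglongrightarrow> complex_of_real (1 - Re (s x))"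
      using sqrt_iter_tendsto[OF pos[OF s]] by (intro tendsto_of_real) simp
  qed
  from multiplier_bound_scale[OF this, of "1/2"]
  have "multiplier_bound S (\<lambda>s. 1/2 * complex_of_real (1 - Re (s x))) (B / 2)"
    by (simp add: norm_divide)
  then show ?thesis
    by (rule multiplier_bound_cong) (simp add: half_dist_def)
qed

text \<open>Doubling \<open>x\<close> at most doubles the distance of \<open>s x\<close> from 1, so
  J halvings can be applied before the distance reaches 1, where the trivial bound takes over. The
  gain is linear in that distance, although the multiplier itself is pointwise quadratic in
  it.\<close>

lemma multiplier_bound_half_dist_small:
  assumes S: "\<And>s. s \<in> S \<Longrightarrow> unitary_hom s"
    and "\<And>s. s \<in> S \<Longrightarrow> cmod (s x - 1) < 1 / 2 ^ J"
  shows "multiplier_bound S (\<lambda>s. of_real (half_dist x s)) (1 / 2 ^ J)"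
  using assms(2)
proof (induction J arbitrary: x)
  case 0
  then show ?case using multiplier_bound_half_dist[OF S] by simp
next
  case (Suc J)
  have "cmod (s (x + x) - 1) < 1 / 2 ^ J" if "s \<in> S" for s
  proof -
    have "s (x + x) - 1 = (s x - 1) * s x + (s x - 1)"
      using S[OF that] by (simp add: unitary_hom_def algebra_simps)
    then have "cmod (s (x + x) - 1) \<le> cmod (s x - 1) * cmod (s x) + cmod (s x - 1)"
      by (metis norm_mult norm_triangle_ineq)
    also have "\<dots> = 2 * cmod (s x - 1)"
      using S[OF that] by (simp add: unitary_hom_def)
    also have "\<dots> < 1 / 2 ^ J" using Suc.prems[OF that] by (simp add: field_simps)
    finally show ?thesis .
  qed
  then have 1: "multiplier_bound S (\<lambda>s. of_real (half_dist (x + x) s)) (1 / 2 ^ J)"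
    by (rule Suc.IH)
  have "0 < Re (s x)" if "s \<in> S" for s
  proof -
    have "(1::real) / 2 ^ Suc J \<le> 1"
      using one_le_power[of "2::real" "Suc J"] by (simp add: divide_le_eq del: power_Suc)
    then have "cmod (1 - s x) < 1"
      using order.strict_trans2[OF Suc.prems[OF that]] by (simp only: norm_minus_commute)
    then show ?thesis using complex_Re_le_cmod[of "1 - s x"] by simp
  qed
  then have "multiplier_bound S (\<lambda>s. of_real (half_dist x s)) (1 / 2 ^ J / 2)"
    by (intro multiplier_bound_halve[OF _ _ 1] S) (auto simp: divide_le_eq)
  then show ?case by (simp add: mult.commute)
qed

text \<open>Interpolation between the bound 1 for powers of \<open>s x\<close> and the bound
  \<open>\<eta>\<close> for the squared difference: n (s x - 1) is (s x)^n - 1 minus a remainder of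
  norm at most n^2 \<open>\<eta>\<close>. For n = 2^m that remainder has norm at most 4, and 6 = 1 +
  1 + 4.\<close>

lemma multiplier_bound_difference:
  assumes S: "\<And>s. s \<in> S \<Longrightarrow> unitary_hom s"
    and small: "\<And>s. s \<in> S \<Longrightarrow> cmod (s x - 1) < 1 / 4 ^ m"
  shows "multiplier_bound S (\<lambda>s. s x - 1) (6 / 2 ^ m)"
proof -
  define \<eta> :: real where "\<eta> = 4 / 4 ^ m"
  have t: "multiplier_bound S (\<lambda>s. s x) 1" for x
    by (rule multiplier_bound_translate) (use S in \<open>auto simp: unitary_hom_def\<close>)
  have "multiplier_bound S (\<lambda>s. of_real (half_dist x s)) (1 / 2 ^ (2 * m))"
    using small by (intro multiplier_bound_half_dist_small S) (auto simp: power_mult)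
  from multiplier_bound_scale[OF multiplier_bound_mult[OF t[of x] this], of "-4"]
  have "multiplier_bound S (\<lambda>s. - 4 * (s x * of_real (half_dist x s))) \<eta>"
    by (simp add: \<eta>_def power_mult)
  \<comment> \<open>On the unit circle (s x - 1)^2 equals -4 times \<open>s x\<close> times
    \<open>half_dist x s\<close>; the factor 4 is the numerator of \<open>\<eta>\<close>.\<close>
  then have sq: "multiplier_bound S (\<lambda>s. (s x - 1)\<^sup>2) \<eta>"
  proof (rule multiplier_bound_cong)
    fix s assume s: "s \<in> S"
    have "s x * cnj (s x) = 1"
      using S[OF s] unfolding unitary_hom_def
      by (metis complex_norm_square of_real_1 power_one)
    moreover have d: "complex_of_real (half_dist x s) = (2 - s x - cnj (s x)) / 4"
      by (simp add: half_dist_def complex_eq_iff)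
    have "- 4 * (s x * of_real (half_dist x s)) = (s x)\<^sup>2 - 2 * s x + s x * cnj (s x)"
      unfolding d by (simp add: power2_eq_square field_simps)
    ultimately show "- 4 * (s x * of_real (half_dist x s)) = (s x - 1)\<^sup>2"
      by (simp add: power2_eq_square algebra_simps)
  qed
  \<comment> \<open>As in Landau's inequality, the first difference is bounded by comparing \<open>s x ^ n - 1\<close> with its
    linearisation, whose error is controlled by second differences; then take \<open>n = 2 ^ m\<close>.\<close>
  have rem: "multiplier_bound S (\<lambda>s. s x ^ n - 1 - of_nat n * (s x - 1)) (real n ^ 2 * \<eta>)" for n
  proof (induction n)
    case 0
    show ?case using multiplier_bound_const[of S 0] by simp
  next
    case (Suc n)
    \<comment> \<open>The next remainder is \<open>s x\<close> times the current one plus n squared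
      differences, so its bound grows from n^2 \<open>\<eta>\<close> to (n^2 + n)
      \<open>\<eta>\<close>, within (n + 1)^2 \<open>\<eta>\<close>.\<close>
    have "multiplier_bound S (\<lambda>s. s x * (s x ^ n - 1 - of_nat n * (s x - 1)) + of_nat n * (s x - 1)\<^sup>2)
        (1 * (real n ^ 2 * \<eta>) + cmod (of_nat n) * \<eta>)"
      by (intro multiplier_bound_add multiplier_bound_mult multiplier_bound_scale t sq Suc)
    then have "multiplier_bound S (\<lambda>s. s x ^ Suc n - 1 - of_nat (Suc n) * (s x - 1))
        (1 * (real n ^ 2 * \<eta>) + cmod (of_nat n) * \<eta>)"
      by (rule multiplier_bound_cong) (simp add: power2_eq_square algebra_simps)
    moreover have "1 * (real n ^ 2 * \<eta>) + cmod (of_nat n) * \<eta> \<le> real (Suc n) ^ 2 * \<eta>"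
      by (simp add: \<eta>_def power2_eq_square field_simps)
    ultimately show ?case by (rule multiplier_bound_mono)
  qed
  have pow: "multiplier_bound S (\<lambda>s. s x ^ n) 1" for n
  proof (induction n)
    case 0
    show ?case using multiplier_bound_const[of S 1] by simp
  next
    case (Suc n)
    from multiplier_bound_mult[OF t[of x] this] show ?case by simp
  qed
  define n :: nat where "n = 2 ^ m"
  have n: "real n = 2 ^ m" "n \<noteq> 0" by (auto simp: n_def)
  have "multiplier_bound S (\<lambda>s. (1 / of_nat n) * (s x ^ n + ((- 1) + (- 1) * (s x ^ n - 1 - of_nat n * (s x - 1)))))
     (cmod (1 / of_nat n) * (1 + (cmod (- 1) + cmod (- 1) * (real n ^ 2 * \<eta>))))"
    by (intro multiplier_bound_scale multiplier_bound_add rem pow multiplier_bound_const)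
  then have "multiplier_bound S (\<lambda>s. s x - 1)
     (cmod (1 / of_nat n) * (1 + (cmod (- 1) + cmod (- 1) * (real n ^ 2 * \<eta>))))"
    by (rule multiplier_bound_cong) (use n in \<open>simp add: field_simps\<close>)
  moreover have "cmod (1 / of_nat n) * (1 + (cmod (- 1) + cmod (- 1) * (real n ^ 2 * \<eta>))) = 6 / 2 ^ m"
  proof -
    have "real n ^ 2 * \<eta> = 4"
      by (simp add: n \<eta>_def power_mult[symmetric] power_mult_distrib mult.commute[of m] flip: power_mult)
         (simp add: power_mult)
    then show ?thesis by (simp add: norm_divide n)
  qed
  ultimately show ?thesis by simp
qed

text \<open>The substitute for Bernstein's inequality: a translation difference is the multiplier
  \<open>s x - 1\<close>. The bound depends neither on the number of frequencies nor on the
  coefficients.\<close>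

theorem trig_poly_difference_bound:
  assumes "\<And>s. s \<in> S \<Longrightarrow> unitary_hom s"
    and "\<And>s. s \<in> S \<Longrightarrow> cmod (s x - 1) < 1 / 4 ^ m"
    and "\<And>y. cmod (\<Sum>s\<in>S. c s * s y) \<le> 1"
  shows "cmod ((\<Sum>s\<in>S. c s * s (x + y)) - (\<Sum>s\<in>S. c s * s y)) \<le> 6 / 2 ^ m"
proof -
  have "(\<Sum>s\<in>S. c s * s (x + y)) - (\<Sum>s\<in>S. c s * s y) = (\<Sum>s\<in>S. c s * (s x - 1) * s y)"
    unfolding sum_subtractf[symmetric]
    by (rule sum.cong) (use assms(1) in \<open>auto simp: unitary_hom_def algebra_simps\<close>)
  moreover have "multiplier_bound S (\<lambda>s. s x - 1) (6 / 2 ^ m)"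
    by (rule multiplier_bound_difference) (use assms in auto)
  ultimately show ?thesis
    using multiplier_boundD[of S _ _ c 1] assms(3) by simp
qed


section \<open>The dual group\<close>

lemma unitary_hom_character: "\<gamma> \<in> characters \<Longrightarrow> unitary_hom \<gamma>"
  by (simp add: characters_def unitary_hom_def)

lemma norm_character: "\<gamma> \<in> characters \<Longrightarrow> cmod (\<gamma> x) = 1"
  by (simp add: characters_def)

lemma character_add: "\<gamma> \<in> characters \<Longrightarrow> \<gamma> (x + y) = \<gamma> x * \<gamma> y"
  by (simp add: characters_def)

lemmas character_zero = unitary_hom_zero[OF unitary_hom_character]
lemmas character_minus = unitary_hom_minus[OF unitary_hom_character]

lemma character_mult_cnj: "\<gamma> \<in> characters \<Longrightarrow> \<gamma> x * cnj (\<gamma> x) = 1"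
  by (metis norm_character complex_norm_square of_real_1 power_one)

lemma continuous_character: "\<gamma> \<in> characters \<Longrightarrow> continuous_on A \<gamma>"
  by (auto simp: characters_def intro: continuous_on_subset)

lemma one_character: "(\<lambda>x. 1) \<in> characters"
  by (simp add: characters_def)

lemma character_mult: "\<gamma> \<in> characters \<Longrightarrow> \<delta> \<in> characters \<Longrightarrow> (\<lambda>x. \<gamma> x * \<delta> x) \<in> characters"
  by (auto simp: characters_def norm_mult intro!: continuous_intros)

lemma character_cnj: "\<gamma> \<in> characters \<Longrightarrow> (\<lambda>x. cnj (\<gamma> x)) \<in> characters"
  by (auto simp: characters_def intro!: continuous_intros)

lemma openin_dual_top_basic:
  assumes "compact K" "\<gamma>0 \<in> characters" "e > 0"
  shows "openin dual_top {\<gamma> \<in> characters. \<forall>x\<in>K. cmod (\<gamma> x - \<gamma>0 x) < e}"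
  unfolding dual_top_def by (rule topology_generated_by_Basis) (use assms in blast)

lemma topspace_dual_top: "topspace (dual_top :: ('g::topological_ab_group_add \<Rightarrow> complex) topology) = characters"
proof -
  \<comment> \<open>Over the empty compact set the basic neighbourhood imposes no condition, so the
    set of all characters is itself a generator.\<close>
  have "{\<gamma> \<in> characters. \<forall>x\<in>({}::'g set). cmod (\<gamma> x - 1) < 1} \<in> 
     {{\<gamma> \<in> characters. \<forall>x\<in>K. cmod (\<gamma> x - \<gamma>0 x) < e} | K \<gamma>0 e.
        compact K \<and> \<gamma>0 \<in> characters \<and> e > (0::real)}"
    using one_character by (intro CollectI exI[of _ "{}"] exI[of _ "\<lambda>x. 1"] exI[of _ 1]) auto
  then have "characters \<in> {{\<gamma> \<in> characters. \<forall>x\<in>K. cmod (\<gamma> x - \<gamma>0 x) < e} | K \<gamma>0 e.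
        compact (K::'g set) \<and> \<gamma>0 \<in> characters \<and> e > (0::real)}"
    by simp
  then show ?thesis
    unfolding dual_top_def topology_generated_by_topspace by fastforce
qed

lemma continuous_map_into_dual_top:
  fixes f :: "'t \<Rightarrow> 'a::topological_ab_group_add \<Rightarrow> complex"
  assumes "f \<in> topspace X \<rightarrow> characters"
    and "\<And>K \<gamma>0 e. compact K \<Longrightarrow> \<gamma>0 \<in> characters \<Longrightarrow> e > 0 \<Longrightarrow>
           openin X {t \<in> topspace X. \<forall>x\<in>K. cmod (f t x - \<gamma>0 x) < e}"
  shows "continuous_map X dual_top f"
  unfolding dual_top_def
proof (rule continuous_on_generated_topo)
  fix U :: "('a \<Rightarrow> complex) set" assume "U \<in> {{\<gamma> \<in> characters. \<forall>x\<in>K. cmod (\<gamma> x - \<gamma>0 x) < e} | K \<gamma>0 e.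
        compact K \<and> \<gamma>0 \<in> characters \<and> e > 0}"
  then obtain K \<gamma>0 e where U: "U = {\<gamma> \<in> characters. \<forall>x\<in>K. cmod (\<gamma> x - \<gamma>0 x) < e}"
    "compact K" "\<gamma>0 \<in> characters" "e > 0" by blast
  have "f -` U \<inter> topspace X = {t \<in> topspace X. \<forall>x\<in>K. cmod (f t x - \<gamma>0 x) < e}"
    using assms(1) U(1) by auto
  then show "openin X (f -` U \<inter> topspace X)" using assms(2)[OF U(2-4)] by simp
next
  show "f ` topspace X \<subseteq> \<Union> {{\<gamma> \<in> characters. \<forall>x\<in>K. cmod (\<gamma> x - \<gamma>0 x) < e} | K \<gamma>0 e.
        compact K \<and> \<gamma>0 \<in> characters \<and> e > 0}"
    using assms(1) topspace_dual_top unfolding dual_top_def topology_generated_by_topspace by blast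
qed

text \<open>As \<open>\<gamma>\<close> has modulus 1, the preimage of a basic set around
  \<open>\<gamma>0\<close> is the basic set with the same compact set and radius around
  \<open>\<gamma>0\<close> times the conjugate of \<open>\<gamma>\<close>.\<close>

lemma continuous_map_dual_translate:
  assumes \<gamma>: "(\<gamma> :: 'a::topological_ab_group_add \<Rightarrow> complex) \<in> characters"
  shows "continuous_map dual_top dual_top (\<lambda>s x. s x * \<gamma> x)"
proof (rule continuous_map_into_dual_top)
  show "(\<lambda>s x. s x * \<gamma> x) \<in> topspace dual_top \<rightarrow> characters"
    by (simp add: topspace_dual_top character_mult \<gamma>)
  fix K :: "'a set" and \<gamma>0 :: "'a \<Rightarrow> complex" and e :: real
  assume A: "compact K" "\<gamma>0 \<in> characters" "e > 0"
  have "cmod (s x * \<gamma> x - \<gamma>0 x) = cmod (s x - \<gamma>0 x * cnj (\<gamma> x))" for s x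
  proof -
    have "s x * \<gamma> x - \<gamma>0 x = (s x - \<gamma>0 x * cnj (\<gamma> x)) * \<gamma> x"
      using character_mult_cnj[OF \<gamma>, of x] by (simp add: algebra_simps)
    then show ?thesis by (simp add: norm_mult norm_character[OF \<gamma>])
  qed
  then show "openin dual_top {s \<in> topspace dual_top. \<forall>x\<in>K. cmod (s x * \<gamma> x - \<gamma>0 x) < e}"
    using openin_dual_top_basic[OF A(1) character_mult[OF A(2) character_cnj[OF \<gamma>]] A(3)]
    by (simp add: topspace_dual_top)
qed

lemma dual_translate_subset: "E \<subseteq> characters \<Longrightarrow> \<gamma> \<in> characters \<Longrightarrow> dual_translate E \<gamma> \<subseteq> characters"
  by (auto simp: dual_translate_def character_mult)

lemma compactin_dual_translate:
  "compactin dual_top E \<Longrightarrow> \<gamma> \<in> characters \<Longrightarrow> compactin dual_top (dual_translate E \<gamma>)"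
  unfolding dual_translate_def by (rule image_compactin[OF _ continuous_map_dual_translate])

lemma openin_dual_translate:
  assumes V: "openin dual_top V" and \<gamma>: "\<gamma> \<in> characters"
  shows "openin dual_top (dual_translate V \<gamma>)"
proof -
  have V': "V \<subseteq> characters" using openin_subset[OF V] by (simp add: topspace_dual_top)
  have "dual_translate V \<gamma> = {s \<in> topspace dual_top. (\<lambda>x. s x * cnj (\<gamma> x)) \<in> V}"
  proof (intro set_eqI iffI)
    fix s assume "s \<in> dual_translate V \<gamma>"
    then obtain t where t: "t \<in> V" "s = (\<lambda>x. t x * \<gamma> x)" by (auto simp: dual_translate_def)
    then have "(\<lambda>x. s x * cnj (\<gamma> x)) = t"
      using character_mult_cnj[OF \<gamma>] by (simp add: mult.assoc)
    with t V' \<gamma> show "s \<in> {s \<in> topspace dual_top. (\<lambda>x. s x * cnj (\<gamma> x)) \<in> V}"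
      by (auto simp: topspace_dual_top intro: character_mult)
  next
    fix s assume s: "s \<in> {s \<in> topspace dual_top. (\<lambda>x. s x * cnj (\<gamma> x)) \<in> V}"
    have "(\<lambda>x. (s x * cnj (\<gamma> x)) * \<gamma> x) = s"
      using character_mult_cnj[OF \<gamma>] by (simp add: mult.assoc mult.commute[of "cnj _"])
    then show "s \<in> dual_translate V \<gamma>"
      using s unfolding dual_translate_def
      by (intro image_eqI[of _ _ "\<lambda>x. s x * cnj (\<gamma> x)"]) auto
  qed
  then show ?thesis
    using openin_continuous_map_preimage[OF continuous_map_dual_translate[OF character_cnj[OF \<gamma>]] V]
    by simp
qed

text \<open>Finitely many translates of \<open>V\<close> cover \<open>C\<close>, and the same
  translates of the closure of \<open>V\<close> form \<open>\<Omega>\<close>. Each closed translate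
  lies in the closure of the open one, which makes the interior dense.\<close>

lemma compactin_subset_regular_compact:
  fixes V C :: "('a::topological_ab_group_add \<Rightarrow> complex) set"
  assumes V: "openin dual_top V" "(\<lambda>x. 1) \<in> V" "compactin dual_top (dual_top closure_of V)"
    and C: "compactin dual_top C"
  obtains \<Omega> where "C \<subseteq> \<Omega>" "compactin dual_top \<Omega>" "dual_top interior_of \<Omega> \<noteq> {}"
    "\<Omega> \<subseteq> dual_top closure_of (dual_top interior_of \<Omega>)"
proof -
  have C': "C \<subseteq> characters"
    using compactin_subset_topspace[OF C] by (simp add: topspace_dual_top)
  have mem: "\<gamma> \<in> dual_translate V \<gamma>" for \<gamma> :: "'a \<Rightarrow> complex"
    unfolding dual_translate_def using V(2) by (rule rev_image_eqI) simp
  have "\<exists>F. finite F \<and> F \<subseteq> (dual_translate V) ` C \<and> C \<subseteq> \<Union>F"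
    by (rule compactinD[OF C]) (use mem C' openin_dual_translate[OF V(1)] in auto)
  then obtain F where F: "finite F" "F \<subseteq> C" "C \<subseteq> \<Union>(dual_translate V ` F)"
    by (metis finite_subset_image)
  \<comment> \<open>The trivial character is added so that the interior is nonempty even when
    \<open>C\<close> is empty.\<close>
  define D where "D = insert (\<lambda>x. 1) F"
  have D: "finite D" "D \<subseteq> characters" "(\<lambda>x. 1) \<in> D"
    using F C' one_character by (auto simp: D_def)
  define U where "U = \<Union>(dual_translate V ` D)"
  define \<Omega> where "\<Omega> = \<Union>(dual_translate (dual_top closure_of V) ` D)"
  have U: "openin dual_top U"
    unfolding U_def using D openin_dual_translate[OF V(1)] by (intro openin_Union) auto
  have "V \<subseteq> dual_top closure_of V"
    using closure_of_subset[OF openin_subset[OF V(1)]] .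
  then have "U \<subseteq> \<Omega>" unfolding U_def \<Omega>_def dual_translate_def by blast
  then have int: "U \<subseteq> dual_top interior_of \<Omega>" using U by (simp add: interior_of_maximal)
  have "dual_translate (dual_top closure_of V) \<gamma> \<subseteq> dual_top closure_of U" if "\<gamma> \<in> D" for \<gamma>
  proof -
    have "dual_translate (dual_top closure_of V) \<gamma> \<subseteq> dual_top closure_of (dual_translate V \<gamma>)"
      unfolding dual_translate_def using D that
      by (intro continuous_map_image_closure_subset continuous_map_dual_translate) auto
    also have "\<dots> \<subseteq> dual_top closure_of U"
      by (intro closure_of_mono) (use that in \<open>auto simp: U_def\<close>)
    finally show ?thesis .
  qed
  then have "\<Omega> \<subseteq> dual_top closure_of U" unfolding \<Omega>_def by blast
  also have "\<dots> \<subseteq> dual_top closure_of (dual_top interior_of \<Omega>)"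
    by (rule closure_of_mono[OF int])
  finally have 1: "\<Omega> \<subseteq> dual_top closure_of (dual_top interior_of \<Omega>)" .
  have 2: "compactin dual_top \<Omega>"
    unfolding \<Omega>_def using D compactin_dual_translate[OF V(3)] by (intro compactin_Union) auto
  have "(\<lambda>x. 1) \<in> U" unfolding U_def using mem D(3) by blast
  then have 3: "dual_top interior_of \<Omega> \<noteq> {}" using int by blast
  have "C \<subseteq> U" using F(3) unfolding U_def D_def by blast
  then have "C \<subseteq> \<Omega>" using \<open>U \<subseteq> \<Omega>\<close> by blast
  with 1 2 3 that show thesis by blast
qed

section \<open>Equicontinuity of characters and of trigonometric polynomials\<close>

text \<open>The form in which compactness of a spectrum enters the difference bound. It passes to
  products of sets of characters by a two-term estimate, so compactness of such products in the dual
  need not be established.\<close>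

definition equicontinuous_at_zero :: "('g::topological_ab_group_add \<Rightarrow> complex) set \<Rightarrow> bool" where
  "equicontinuous_at_zero E \<longleftrightarrow>
     (\<forall>d>0. \<exists>U. open U \<and> 0 \<in> U \<and> (\<forall>s\<in>E. \<forall>x\<in>U. cmod (s x - 1) < d))"

lemma equicontinuous_at_zero_singleton:
  assumes "\<gamma> \<in> characters" "d > 0"
  shows "\<exists>U. open U \<and> 0 \<in> U \<and> (\<forall>x\<in>U. cmod (\<gamma> x - 1) < d)"
proof (intro exI conjI)
  show "open (\<gamma> -` ball 1 d)"
    using continuous_character[OF assms(1), of UNIV] by (simp add: continuous_on_open_vimage)
  show "0 \<in> \<gamma> -` ball 1 d" using assms by (simp add: character_zero)
  show "\<forall>x\<in>\<gamma> -` ball 1 d. cmod (\<gamma> x - 1) < d" by (simp add: dist_norm norm_minus_commute)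
qed

text \<open>Local compactness gives a compact neighbourhood \<open>K\<close> of 0. Basic sets over
  \<open>K\<close> approximate all of \<open>E\<close> near 0 by finitely many characters, each of
  which is continuous at 0.\<close>

lemma compactin_imp_equicontinuous:
  assumes lc: "locally_compact_space (euclidean :: 'g topology)"
    and E: "compactin dual_top (E :: ('g::{topological_ab_group_add, t2_space} \<Rightarrow> complex) set)"
  shows "equicontinuous_at_zero E"
  unfolding equicontinuous_at_zero_def
proof (intro allI impI)
  fix d :: real assume d: "d > 0"
  have "\<exists>W. open W \<and> (\<exists>K. compact K \<and> (0::'g) \<in> W \<and> W \<subseteq> K)"
    using lc by (simp add: locally_compact_space_def)
  then obtain W K where W: "open W" "compact K" "(0::'g) \<in> W" "W \<subseteq> K" by blast
  let ?N = "\<lambda>\<gamma>0. {\<gamma> \<in> characters. \<forall>x\<in>K. cmod (\<gamma> x - \<gamma>0 x) < d / 2}"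
  have E': "E \<subseteq> characters"
    using compactin_subset_topspace[OF E] by (simp add: topspace_dual_top)
  have "\<exists>F. finite F \<and> F \<subseteq> ?N ` E \<and> E \<subseteq> \<Union>F"
  proof (rule compactinD[OF E])
    show "openin dual_top U" if "U \<in> ?N ` E" for U
    proof -
      from that obtain \<gamma>0 where "\<gamma>0 \<in> E" "U = ?N \<gamma>0" by blast
      then show ?thesis using E' d W(2) openin_dual_top_basic[of K \<gamma>0 "d / 2"] by auto
    qed
    show "E \<subseteq> \<Union>(?N ` E)"
      using E' d by fastforce
  qed
  then obtain F where F: "finite F" "F \<subseteq> E" "E \<subseteq> \<Union>(?N ` F)"
    by (metis (no_types, lifting) finite_subset_image)
  have "\<forall>\<gamma>\<in>F. \<exists>U. open U \<and> 0 \<in> U \<and> (\<forall>x\<in>U. cmod (\<gamma> x - 1) < d / 2)"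
    using F(2) E' d by (intro ballI equicontinuous_at_zero_singleton) auto
  then obtain U where U: "\<And>\<gamma>. \<gamma> \<in> F \<Longrightarrow> open (U \<gamma>) \<and> 0 \<in> U \<gamma> \<and> (\<forall>x\<in>U \<gamma>. cmod (\<gamma> x - 1) < d / 2)"
    by metis
  show "\<exists>U. open U \<and> 0 \<in> U \<and> (\<forall>s\<in>E. \<forall>x\<in>U. cmod (s x - 1) < d)"
  proof (intro exI conjI ballI)
    show "open (W \<inter> \<Inter>(U ` F))" using W F U by (intro open_Int open_INT) auto
    show "0 \<in> W \<inter> \<Inter>(U ` F)" using W U by auto
    fix s x assume s: "s \<in> E" and x: "x \<in> W \<inter> \<Inter>(U ` F)"
    from s F(3) obtain \<gamma> where \<gamma>: "\<gamma> \<in> F" "\<forall>x\<in>K. cmod (s x - \<gamma> x) < d / 2" by auto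
    have "cmod (s x - \<gamma> x) < d / 2" "cmod (\<gamma> x - 1) < d / 2"
      using \<gamma> x W(4) U[OF \<gamma>(1)] by auto
    then show "cmod (s x - 1) < d"
      using norm_triangle_ineq[of "s x - \<gamma> x" "\<gamma> x - 1"] by simp
  qed
qed

lemma equicontinuous_at_zero_mult:
  assumes A: "equicontinuous_at_zero A" "A \<subseteq> characters" and B: "equicontinuous_at_zero B"
  shows "equicontinuous_at_zero (\<Union>\<gamma>\<in>B. dual_translate A \<gamma>)"
  unfolding equicontinuous_at_zero_def
proof (intro allI impI)
  fix d :: real assume d: "d > 0"
  obtain U where U: "open U" "0 \<in> U" "\<And>s x. s \<in> A \<Longrightarrow> x \<in> U \<Longrightarrow> cmod (s x - 1) < d / 2"
    using A(1) d unfolding equicontinuous_at_zero_def by (meson half_gt_zero)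
  obtain W where W: "open W" "0 \<in> W" "\<And>s x. s \<in> B \<Longrightarrow> x \<in> W \<Longrightarrow> cmod (s x - 1) < d / 2"
    using B d unfolding equicontinuous_at_zero_def by (meson half_gt_zero)
  show "\<exists>U. open U \<and> 0 \<in> U \<and> (\<forall>s\<in>\<Union>\<gamma>\<in>B. dual_translate A \<gamma>. \<forall>x\<in>U. cmod (s x - 1) < d)"
  proof (intro exI conjI ballI)
    fix s x assume "s \<in> (\<Union>\<gamma>\<in>B. dual_translate A \<gamma>)" and x: "x \<in> U \<inter> W"
    then obtain t \<gamma> where t: "t \<in> A" "\<gamma> \<in> B" "s = (\<lambda>x. t x * \<gamma> x)"
      by (auto simp: dual_translate_def)
    have "s x - 1 = t x * (\<gamma> x - 1) + (t x - 1)" by (simp add: t algebra_simps)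
    then have "cmod (s x - 1) \<le> cmod (t x) * cmod (\<gamma> x - 1) + cmod (t x - 1)"
      by (metis norm_mult norm_triangle_ineq)
    also have "cmod (t x) = 1" using t A(2) by (auto simp: norm_character)
    finally show "cmod (s x - 1) < d"
      using U(3)[OF t(1)] W(3)[OF t(2)] x by fastforce
  qed (use U W in auto)
qed

text \<open>Equicontinuity passes from the characters in \<open>E\<close> to the whole unit ball of
  polynomials with spectrum in \<open>E\<close>. The price is a smaller neighbourhood, where the
  characters are within 4^(-m) of 1, with 6 / 2^m below \<open>\<eta>\<close>.\<close>

lemma trig_poly_equicontinuous:
  assumes E: "equicontinuous_at_zero E" "E \<subseteq> characters" and "\<eta> > 0"
  shows "\<exists>U. open U \<and> 0 \<in> U \<and>
    (\<forall>S c x y. S \<subseteq> E \<longrightarrow> (\<forall>y. cmod (\<Sum>s\<in>S. c s * s y) \<le> 1) \<longrightarrow> x \<in> U \<longrightarrow>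
       cmod ((\<Sum>s\<in>S. c s * s (x + y)) - (\<Sum>s\<in>S. c s * s y)) \<le> \<eta>)"
proof -
  have "(\<lambda>m. 6 * (1 / 2 :: real) ^ m) \<longlonglongrightarrow> 6 * 0"
    by (intro tendsto_intros LIMSEQ_realpow_zero) auto
  then have "\<forall>\<^sub>F m in sequentially. 6 * (1 / 2) ^ m < \<eta>"
    using \<open>\<eta> > 0\<close> by (simp add: order_tendsto_iff)
  then obtain m :: nat where m: "6 * (1 / 2) ^ m < \<eta>"
    by (metis eventually_sequentially order_refl)
  obtain U where U: "open U" "0 \<in> U" "\<And>s x. s \<in> E \<Longrightarrow> x \<in> U \<Longrightarrow> cmod (s x - 1) < 1 / 4 ^ m"
    using E(1)[unfolded equicontinuous_at_zero_def, rule_format, of "1 / 4 ^ m"] by auto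
  show ?thesis
  proof (intro exI conjI allI impI)
    fix S c x y
    assume S: "S \<subseteq> E" "\<forall>y. cmod (\<Sum>s\<in>S. c s * s y) \<le> 1" and x: "x \<in> U"
    have "unitary_hom s" "cmod (s x - 1) < 1 / 4 ^ m" if "s \<in> S" for s
      using that S(1) E(2) U(3) x by (blast intro: unitary_hom_character)+
    then have "cmod ((\<Sum>s\<in>S. c s * s (x + y)) - (\<Sum>s\<in>S. c s * s y)) \<le> 6 / 2 ^ m"
      using S(2) by (intro trig_poly_difference_bound) auto
    then show "cmod ((\<Sum>s\<in>S. c s * s (x + y)) - (\<Sum>s\<in>S. c s * s y)) \<le> \<eta>"
      using m by (simp add: power_one_over)
  qed (fact U(1,2))+
qed

lemma compact_group_cover:
  fixes K U :: "'g::topological_ab_group_add set"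
  assumes "compact K" "open U" "0 \<in> U"
  obtains X where "finite X" "X \<subseteq> K" "\<forall>y\<in>K. \<exists>x\<in>X. y - x \<in> U"
proof -
  have "open ((\<lambda>y. y - x) -` U)" for x
    by (intro open_vimage assms(2) continuous_intros)
  moreover have "K \<subseteq> (\<Union>x\<in>K. (\<lambda>y. y - x) -` U)" using assms(3) by auto
  ultimately obtain X where X: "X \<subseteq> K" "finite X" "K \<subseteq> (\<Union>x\<in>X. (\<lambda>y. y - x) -` U)"
    using compactE_image[OF assms(1), of K "\<lambda>x. (\<lambda>y. y - x) -` U"] by metis
  then have "\<forall>y\<in>K. \<exists>x\<in>X. y - x \<in> U" by auto
  with X(2,1) show thesis by (rule that)
qed

text \<open>An Ascoli argument: functions are sampled at a finite set \<open>X\<close>, and the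
  samples are rounded to a grid of mesh \<open>\<eta>\<close>. Only finitely many codes occur, and
  one representative per code is kept. Equal codes mean samples within 2 \<open>\<eta>\<close> (real
  and imaginary part), and moving from a sample point costs \<open>\<eta>\<close> for each of the
  two functions. The net is taken inside \<open>F\<close>, so its members are again polynomials of
  the given kind.\<close>

lemma equicontinuous_finite_net:
  fixes F :: "('g::topological_ab_group_add \<Rightarrow> complex) set"
  assumes bd: "\<And>q y. q \<in> F \<Longrightarrow> cmod (q y) \<le> 1"
    and U: "open U" "0 \<in> U" "\<And>q x y. q \<in> F \<Longrightarrow> x \<in> U \<Longrightarrow> cmod (q (x + y) - q y) \<le> \<eta>"
    and K: "compact K" and \<eta>: "\<eta> > 0"
  obtains N where "finite N" "N \<subseteq> F" "\<forall>q\<in>F. \<exists>q'\<in>N. \<forall>y\<in>K. cmod (q y - q' y) \<le> 4 * \<eta>"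
proof -
  obtain X where X: "finite X" "X \<subseteq> K" "\<forall>y\<in>K. \<exists>x\<in>X. y - x \<in> U"
    using compact_group_cover[OF K U(1,2)] .
  define cell where "cell z = (\<lfloor>Re z / \<eta>\<rfloor>, \<lfloor>Im z / \<eta>\<rfloor>)" for z
  define \<Phi> where "\<Phi> q = restrict (\<lambda>x. cell (q x)) X" for q
  let ?R = "{\<lfloor>- 1 / \<eta>\<rfloor>..\<lfloor>1 / \<eta>\<rfloor>} \<times> {\<lfloor>- 1 / \<eta>\<rfloor>..\<lfloor>1 / \<eta>\<rfloor>}"
  have "cell z \<in> ?R" if "cmod z \<le> 1" for z
  proof -
    have "\<bar>Re z\<bar> \<le> 1" "\<bar>Im z\<bar> \<le> 1"
      using abs_Re_le_cmod[of z] abs_Im_le_cmod[of z] that by auto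
    then have "- 1 / \<eta> \<le> Re z / \<eta>" "Re z / \<eta> \<le> 1 / \<eta>" "- 1 / \<eta> \<le> Im z / \<eta>" "Im z / \<eta> \<le> 1 / \<eta>"
      using \<eta> by (intro divide_right_mono; simp)+
    then show ?thesis by (simp add: cell_def floor_mono)
  qed
  then have "\<Phi> ` F \<subseteq> X \<rightarrow>\<^sub>E ?R" using bd by (auto simp: \<Phi>_def PiE_def)
  moreover have "finite (X \<rightarrow>\<^sub>E ?R)" using X by (intro finite_PiE) auto
  ultimately have "finite (\<Phi> ` F)" by (rule finite_subset)
  then obtain N where N: "N \<subseteq> F" "finite N" "\<Phi> ` F = \<Phi> ` N"
    using finite_subset_image[of "\<Phi> ` F" \<Phi> F] by blast
  have close: "cmod (z - w) \<le> 2 * \<eta>" if "cell z = cell w" for z w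
  proof -
    have *: "\<bar>a - b\<bar> \<le> \<eta>" if "\<lfloor>a / \<eta>\<rfloor> = \<lfloor>b / \<eta>\<rfloor>" for a b
    proof -
      have "\<bar>a / \<eta> - b / \<eta>\<bar> < 1" using that by linarith
      then have "\<bar>(a - b) / \<eta>\<bar> < 1" by (simp add: diff_divide_distrib)
      then show ?thesis using \<eta> by (simp add: abs_divide divide_less_eq)
    qed
    have "\<bar>Re (z - w)\<bar> \<le> \<eta>" "\<bar>Im (z - w)\<bar> \<le> \<eta>"
      using that * by (auto simp: cell_def)
    then show ?thesis using cmod_le[of "z - w"] by linarith
  qed
  show thesis
  proof (rule that[OF N(2,1)], rule ballI)
    fix q assume q: "q \<in> F"
    then obtain q' where q': "q' \<in> N" "\<Phi> q = \<Phi> q'" using N(3) by (metis imageE imageI)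
    have "cmod (q y - q' y) \<le> 4 * \<eta>" if y: "y \<in> K" for y
    proof -
      obtain x where x: "x \<in> X" "y - x \<in> U" using X(3) y by blast
      have "cell (q x) = cell (q' x)"
        using fun_cong[OF q'(2), of x] x by (simp add: \<Phi>_def)
      then have 1: "cmod (q x - q' x) \<le> 2 * \<eta>" by (rule close)
      have 2: "cmod (q y - q x) \<le> \<eta>" using U(3)[OF q x(2), of x] by simp
      have 3: "cmod (q' y - q' x) \<le> \<eta>" using U(3)[of q' "y - x" x] q' N(1) x(2) by auto
      have "q y - q' y = (q y - q x) + (q x - q' x) - (q' y - q' x)" by simp
      then have "cmod (q y - q' y) \<le> cmod (q y - q x) + cmod (q x - q' x) + cmod (q' y - q' x)"
        by (smt (verit) norm_triangle_ineq norm_triangle_ineq4)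
      with 1 2 3 show ?thesis by linarith
    qed
    with q'(1) show "\<exists>q'\<in>N. \<forall>y\<in>K. cmod (q y - q' y) \<le> 4 * \<eta>" by blast
  qed
qed


section \<open>Testing measures against trigonometric polynomials\<close>

lemma space_of_sets_borel: "sets M = sets borel \<Longrightarrow> space M = UNIV"
  by (metis sets_eq_imp_space_eq space_borel)

lemma continuous_imp_measurable_borel_sets:
  fixes f :: "'a::topological_space \<Rightarrow> 'b::topological_space"
  assumes "sets M = sets borel" "continuous_on UNIV f"
  shows "f \<in> borel_measurable M"
  using borel_measurable_continuous_onI[OF assms(2)] measurable_cong_sets[OF assms(1) refl] by blast

lemma continuous_on_character_minus: "\<gamma> \<in> characters \<Longrightarrow> continuous_on A (\<lambda>x. \<gamma> (a - x))"
  by (rule continuous_on_compose2[OF continuous_character[of \<gamma> UNIV]]) (auto intro!: continuous_intros)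

lemma integrable_bounded_mult:
  fixes g h :: "'a \<Rightarrow> complex"
  assumes h: "integrable M h" and g: "g \<in> borel_measurable M" "\<And>x. cmod (g x) \<le> B"
  shows "integrable M (\<lambda>x. g x * h x)"
proof (rule Bochner_Integration.integrable_bound)
  show "integrable M (\<lambda>x. B * cmod (h x))" using h by simp
  have "cmod (g x * h x) \<le> norm (B * cmod (h x))" for x
  proof -
    have "cmod (g x * h x) \<le> B * cmod (h x)"
      unfolding norm_mult by (intro mult_right_mono g) simp
    then show ?thesis by simp
  qed
  then show "AE x in M. cmod (g x * h x) \<le> norm (B * cmod (h x))" by simp
qed (use h g in measurable)

lemma integrable_tail:
  assumes "integrable M h" "A \<in> sets M"
  shows "integrable M (\<lambda>x. indicator A x * cmod (h x))"
proof -
  have "integrable M (\<lambda>x. indicator A x *\<^sub>R cmod (h x))"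
    using assms by (intro integrable_mult_indicator integrable_norm)
  then show ?thesis by simp
qed

text \<open>Here \<open>A\<close> is the exceptional set, typically the complement of a compact set
  that carries most of the mass: off it \<open>g\<close> is small, on it only the crude bound
  \<open>B\<close> is available.\<close>

lemma integral_bounded_mult:
  fixes g h :: "'a \<Rightarrow> complex"
  assumes h: "integrable M h" and g: "g \<in> borel_measurable M" "\<And>x. cmod (g x) \<le> B"
    and A: "A \<in> sets M" "\<And>x. x \<notin> A \<Longrightarrow> cmod (g x) \<le> \<eta>" and "0 \<le> \<eta>" 
  shows "cmod (\<integral>x. g x * h x \<partial>M) \<le> \<eta> * (\<integral>x. cmod (h x) \<partial>M) + B * (\<integral>x. indicator A x * cmod (h x) \<partial>M)"
proof -
  have B: "0 \<le> B" using g(2) norm_ge_zero order_trans by blast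
  note gi = integrable_bounded_mult[OF h g]
  have "cmod (\<integral>x. g x * h x \<partial>M) \<le> (\<integral>x. cmod (g x * h x) \<partial>M)"
    by (rule integral_norm_bound)
  also have "\<dots> \<le> (\<integral>x. \<eta> * cmod (h x) + B * (indicator A x * cmod (h x)) \<partial>M)"
  proof (rule integral_mono)
    show "integrable M (\<lambda>x. \<eta> * cmod (h x) + B * (indicator A x * cmod (h x)))"
      using h integrable_tail[OF h A(1)] by (intro Bochner_Integration.integrable_add integrable_mult_right integrable_norm)
    show "cmod (g x * h x) \<le> \<eta> * cmod (h x) + B * (indicator A x * cmod (h x))" for x
    proof (cases "x \<in> A")
      case True
      have "cmod (g x) * cmod (h x) \<le> B * cmod (h x)" using g(2) by (intro mult_right_mono) auto
      moreover have "0 \<le> \<eta> * cmod (h x)" using \<open>0 \<le> \<eta>\<close> by simp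
      ultimately show ?thesis using True by (simp add: norm_mult)
    next
      case False
      have "cmod (g x) * cmod (h x) \<le> \<eta> * cmod (h x)" using A(2)[OF False] by (intro mult_right_mono) auto
      then show ?thesis using False by (simp add: norm_mult)
    qed
  qed (use gi in simp)
  also have "\<dots> = \<eta> * (\<integral>x. cmod (h x) \<partial>M) + B * (\<integral>x. indicator A x * cmod (h x) \<partial>M)"
    using h integrable_tail[OF h A(1)] by simp
  finally show ?thesis .
qed

section \<open>Tightness, and decay of the local norms\<close>

lemma finite_radon_tight:
  fixes \<nu> :: "'g::t2_space measure"
  assumes "finite_radon \<nu>" "e > 0"
  obtains K where "compact K" "measure \<nu> (- K) < e"
proof -
  interpret finite_measure \<nu> using assms by (simp add: finite_radon_def)
  have sets: "sets \<nu> = sets borel" and sp: "space \<nu> = UNIV"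
    using assms space_of_sets_borel by (auto simp: finite_radon_def)
  have K_sets: "K \<in> sets \<nu>" if "compact K" for K
    using sets borel_compact[OF that] by simp
  have eq: "emeasure \<nu> UNIV = (SUP K\<in>{K. K \<subseteq> UNIV \<and> compact K}. emeasure \<nu> K)"
    using assms by (auto simp: finite_radon_def)
  have "\<exists>K. compact K \<and> measure \<nu> (- K) < e"
  \<comment> \<open>The split keeps the difference of the total mass and \<open>e\<close>
    nonnegative, since \<open>ennreal\<close> truncates negative numbers at 0.\<close>
  proof (cases "measure \<nu> UNIV < e")
    case True
    then show ?thesis by (intro exI[of _ "{}"]) simp
  next
    case False
    have "ennreal (measure \<nu> UNIV - e) < ennreal (measure \<nu> UNIV)"
      using assms False by (intro ennreal_lessI) linarith+
    also have "\<dots> = (SUP K\<in>{K. K \<subseteq> UNIV \<and> compact K}. emeasure \<nu> K)"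
      using eq by (simp only: emeasure_eq_measure)
    finally obtain K where K: "compact K" "ennreal (measure \<nu> UNIV - e) < emeasure \<nu> K"
      unfolding less_SUP_iff by auto
    then have "measure \<nu> UNIV - e < measure \<nu> K"
      using False assms by (simp add: emeasure_eq_measure ennreal_less_iff)
    moreover have "measure \<nu> (- K) = measure \<nu> UNIV - measure \<nu> K"
      using finite_measure_compl[OF K_sets[OF K(1)]] by (simp add: sp Compl_eq_Diff_UNIV)
    ultimately show ?thesis using K(1) by auto
  qed
  then show thesis using that by blast
qed

text \<open>The density \<open>h\<close> may be unbounded, so a set of small measure need not
  obviously have small integral. Cutting the modulus of \<open>h\<close> at height n leaves an
  excess with small integral, by dominated convergence; the part below n is handled by tightness of
  \<open>\<nu>\<close>.\<close>

lemma in_M_tight: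
  fixes \<nu> :: "'g::{topological_ab_group_add, t2_space} measure"
  assumes M: "in_M \<nu> h" and "e > 0"
  obtains K where "compact K" "(\<integral>x. indicator (- K) x * cmod (h x) \<partial>\<nu>) < e"
proof -
  have R: "finite_radon \<nu>" and h: "integrable \<nu> h" using M by (auto simp: in_M_def)
  interpret finite_measure \<nu> using R by (simp add: finite_radon_def)
  have sets: "sets \<nu> = sets borel" using R by (auto simp: finite_radon_def)
  let ?t = "\<lambda>n x. max 0 (cmod (h x) - real n)"
  have ti: "integrable \<nu> (?t n)" for n
    by (rule Bochner_Integration.integrable_bound[OF integrable_norm[OF h]]) (use h in auto)
  have "(\<lambda>n. \<integral>x. ?t n x \<partial>\<nu>) \<longlonglongrightarrow> (\<integral>x. 0 \<partial>\<nu>)"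
  proof (rule integral_dominated_convergence[where w = "\<lambda>x. cmod (h x)"])
    have "(\<lambda>n. ?t n x) \<longlonglongrightarrow> 0" for x
    proof (rule tendsto_eventually)
      obtain N :: nat where "cmod (h x) \<le> real N" using real_arch_simple by blast
      then show "\<forall>\<^sub>F n in sequentially. ?t n x = 0"
        by (intro eventually_sequentiallyI[of N]) auto
    qed
    then show "AE x in \<nu>. (\<lambda>n. ?t n x) \<longlonglongrightarrow> 0" by simp
  qed (use h in auto)
  then have "\<forall>\<^sub>F n in sequentially. (\<integral>x. ?t n x \<partial>\<nu>) < e / 2"
    using \<open>e > 0\<close> by (intro order_tendstoD(2)) auto
  then obtain n where n: "(\<integral>x. ?t n x \<partial>\<nu>) < e / 2"
    by (metis (no_types, lifting) eventually_sequentially order_refl)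
  \<comment> \<open>Dividing by \<open>real n + 1\<close> rather than \<open>real n\<close> also
    covers n = 0.\<close>
  obtain K where K: "compact K" "measure \<nu> (- K) < e / 2 / (real n + 1)"
    using finite_radon_tight[OF R, of "e / 2 / (real n + 1)"] \<open>e > 0\<close> by auto
  have Ks: "- K \<in> sets \<nu>" using borel_compact[OF K(1)] by (simp add: sets)
  have "(\<integral>x. indicator (- K) x * cmod (h x) \<partial>\<nu>) \<le> (\<integral>x. real n * indicator (- K) x + ?t n x \<partial>\<nu>)"
  proof (rule integral_mono)
    show "integrable \<nu> (\<lambda>x. real n * indicator (- K) x + ?t n x)"
      using ti Ks by (intro Bochner_Integration.integrable_add integrable_mult_right) (auto simp: emeasure_eq_measure)
  qed (use integrable_tail[OF h Ks] in \<open>auto split: split_indicator\<close>)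
  also have "\<dots> = real n * measure \<nu> (- K) + (\<integral>x. ?t n x \<partial>\<nu>)"
    using ti Ks by (subst Bochner_Integration.integral_add) (auto simp: emeasure_eq_measure)
  also have "real n * measure \<nu> (- K) \<le> (real n + 1) * measure \<nu> (- K)"
    by (intro mult_right_mono) auto
  also have "(real n + 1) * measure \<nu> (- K) \<le> e / 2"
    using K(2) by (simp add: field_simps)
  finally show thesis using n that[OF K(1)] by linarith
qed

lemma integrable_fourier:
  fixes \<gamma> :: "'g::topological_ab_group_add \<Rightarrow> complex"
  assumes "sets M = sets borel" "integrable M h" "\<gamma> \<in> characters"
  shows "integrable M (\<lambda>x. \<gamma> (- x) * h x)"
  using continuous_on_character_minus[OF assms(3), of UNIV 0]
  by (intro integrable_bounded_mult[where B = 1] assms continuous_imp_measurable_borel_sets)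
     (auto simp: norm_character[OF assms(3)])

lemma sum_fourier_meas:
  fixes S :: "('g::topological_ab_group_add \<Rightarrow> complex) set"
  assumes "sets M = sets borel" "integrable M h" "S \<subseteq> characters"
  shows "(\<Sum>s\<in>S. c s * fourier_meas M h s) = (\<integral>x. (\<Sum>s\<in>S. c s * s (- x)) * h x \<partial>M)"
proof -
  have "(\<Sum>s\<in>S. c s * fourier_meas M h s) = (\<Sum>s\<in>S. (\<integral>x. c s * (s (- x) * h x) \<partial>M))"
    by (simp add: fourier_meas_def)
  also have "\<dots> = (\<integral>x. (\<Sum>s\<in>S. c s * (s (- x) * h x)) \<partial>M)"
    by (rule Bochner_Integration.integral_sum[symmetric])
       (use integrable_fourier[OF assms(1,2)] assms(3) in auto)
  finally show ?thesis by (simp add: sum_distrib_right mult.assoc)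
qed

lemma continuous_on_trig_poly_minus:
  "S \<subseteq> characters \<Longrightarrow> continuous_on A (\<lambda>x. \<Sum>s\<in>S. c s * s (a - x))"
  by (intro continuous_intros continuous_on_character_minus) auto

text \<open>The vanishing half of \<open>C0_dual\<close>. Continuity is automatic for transforms of
  measures, so it is split off and proved once.\<close>

definition dual_decay :: "(('g::topological_ab_group_add \<Rightarrow> complex) \<Rightarrow> complex) \<Rightarrow> bool" where
  "dual_decay \<phi> \<longleftrightarrow> (\<forall>e>0. \<exists>K. compactin dual_top K \<and> (\<forall>\<gamma>\<in>characters - K. cmod (\<phi> \<gamma>) < e))"

lemma trig_sum_decay:
  fixes \<phi> :: "('g::topological_ab_group_add \<Rightarrow> complex) \<Rightarrow> complex"
  assumes \<phi>: "dual_decay \<phi>" and S: "finite S" "S \<subseteq> characters" and "e > 0"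
  shows "\<exists>C. compactin dual_top C \<and>
    (\<forall>\<gamma>\<in>characters - C. cmod (\<Sum>s\<in>S. c s * \<phi> (\<lambda>x. s x * \<gamma> x)) \<le> e)"
proof -
  define A where "A = (\<Sum>s\<in>S. cmod (c s))"
  have A: "A \<ge> 0" by (simp add: A_def sum_nonneg)
  obtain K where K: "compactin dual_top K" "\<And>\<gamma>. \<gamma> \<in> characters - K \<Longrightarrow> cmod (\<phi> \<gamma>) < e / (A + 1)"
    using \<phi> \<open>e > 0\<close> A unfolding dual_decay_def by (metis add_nonneg_pos divide_pos_pos zero_less_one)
  \<comment> \<open>The product of \<open>s\<close> and \<open>\<gamma>\<close> lies in
    \<open>K\<close> only if \<open>\<gamma>\<close> lies in \<open>K\<close> translated by the
    conjugate of \<open>s\<close>; outside \<open>?C\<close> this happens for no frequency of the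
    polynomial.\<close>
  let ?C = "\<Union>((\<lambda>s. dual_translate K (\<lambda>x. cnj (s x))) ` S)"
  show ?thesis
  proof (intro exI conjI ballI)
    show "compactin dual_top ?C"
      using S by (intro compactin_Union) (auto intro!: compactin_dual_translate K(1) character_cnj)
    fix \<gamma> :: "'g \<Rightarrow> complex" assume \<gamma>: "\<gamma> \<in> characters - ?C"
    have "cmod (\<phi> (\<lambda>x. s x * \<gamma> x)) \<le> e / (A + 1)" if s: "s \<in> S" for s
    proof -
      have "(\<lambda>x. s x * \<gamma> x) \<notin> K"
      proof
        assume "(\<lambda>x. s x * \<gamma> x) \<in> K"
        moreover have "(\<lambda>x. (s x * \<gamma> x) * cnj (s x)) = \<gamma>"
          using character_mult_cnj[of s] s S(2) by (auto simp: mult_ac fun_eq_iff)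
        ultimately have "\<gamma> \<in> dual_translate K (\<lambda>x. cnj (s x))"
          unfolding dual_translate_def by (intro image_eqI[of _ _ "\<lambda>x. s x * \<gamma> x"]) auto
        with \<gamma> s show False by blast
      qed
      moreover have "(\<lambda>x. s x * \<gamma> x) \<in> characters" using \<gamma> s S(2) by (intro character_mult) auto
      ultimately show ?thesis using K(2) by (simp add: less_imp_le)
    qed
    then have "cmod (\<Sum>s\<in>S. c s * \<phi> (\<lambda>x. s x * \<gamma> x)) \<le> (\<Sum>s\<in>S. cmod (c s) * (e / (A + 1)))"
      by (intro sum_norm_le) (simp add: norm_mult mult_left_mono del: times_divide_eq_right)
    also have "\<dots> = A * (e / (A + 1))" unfolding A_def by (rule sum_distrib_right[symmetric])
    also have "\<dots> \<le> e" using A \<open>e > 0\<close> by (simp add: field_simps)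
    finally show "cmod (\<Sum>s\<in>S. c s * \<phi> (\<lambda>x. s x * \<gamma> x)) \<le> e" .
  qed
qed

text \<open>Pairs of spectrum and coefficients rather than functions, so that the pairing in
  \<open>loc_norm\<close> can be written down directly.\<close>

definition trig_unit_ball :: "('g \<Rightarrow> complex) set \<Rightarrow> (('g \<Rightarrow> complex) set \<times> (('g \<Rightarrow> complex) \<Rightarrow> complex)) set" where
  "trig_unit_ball E = {(S, c). finite S \<and> S \<subseteq> E \<and> (\<forall>x. cmod (\<Sum>s\<in>S. c s * s x) \<le> 1)}"

text \<open>The sum equals the integral of P(-x) against the measure twisted by
  \<open>\<gamma>\<close>. The density keeps its modulus, so replacing P by a member of the net
  costs the same for every \<open>\<gamma>\<close>: \<open>\<epsilon>\<close> / 3 on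
  \<open>K\<close> and \<open>\<epsilon>\<close> / 3 off it. The last third is the decay for the
  finitely many net polynomials.\<close>

lemma fourier_local_decay:
  fixes \<nu> :: "'g::{topological_ab_group_add, t2_space} measure"
  assumes M: "in_M \<nu> h" and decay: "dual_decay (fourier_meas \<nu> h)"
    and E: "equicontinuous_at_zero E" "E \<subseteq> characters" and "\<epsilon> > 0"
  shows "\<exists>C. compactin dual_top C \<and> (\<forall>\<gamma>\<in>characters - C. \<forall>(S, c)\<in>trig_unit_ball E.
       cmod (\<Sum>s\<in>S. c s * fourier_meas \<nu> h (\<lambda>x. s x * \<gamma> x)) \<le> \<epsilon>)"
proof -
  have h: "integrable \<nu> h" and sets: "sets \<nu> = sets borel"
    using M by (auto simp: in_M_def finite_radon_def)
  define T where "T = (\<integral>x. cmod (h x) \<partial>\<nu>)"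
  have T: "T \<ge> 0" by (simp add: T_def)
  \<comment> \<open>The net has precision 4 \<open>\<eta>\<close>, and 4 \<open>\<eta>\<close> times
    the total mass \<open>T\<close> has to stay below \<open>\<epsilon>\<close> / 3;
    \<open>T + 1\<close> avoids division by zero.\<close>
  define \<eta> where "\<eta> = \<epsilon> / (12 * (T + 1))"
  have \<eta>: "\<eta> > 0" "4 * \<eta> * T \<le> \<epsilon> / 3" using T \<open>\<epsilon> > 0\<close> by (auto simp: \<eta>_def field_simps)
  obtain K where K: "compact K" "(\<integral>x. indicator (- K) x * cmod (h x) \<partial>\<nu>) < \<epsilon> / 6"
    using in_M_tight[OF M, of "\<epsilon> / 6"] \<open>\<epsilon> > 0\<close> by auto
  define poly where "poly = (\<lambda>(S :: ('g \<Rightarrow> complex) set, c :: ('g \<Rightarrow> complex) \<Rightarrow> complex) y. \<Sum>s\<in>S. c s * s y)"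
  obtain U where U: "open U" "0 \<in> U"
    "\<forall>S c x y. S \<subseteq> E \<longrightarrow> (\<forall>y. cmod (\<Sum>s\<in>S. c s * s y) \<le> 1) \<longrightarrow> x \<in> U \<longrightarrow>
       cmod ((\<Sum>s\<in>S. c s * s (x + y)) - (\<Sum>s\<in>S. c s * s y)) \<le> \<eta>"
    using trig_poly_equicontinuous[OF E \<eta>(1)] by blast
  \<comment> \<open>The transform uses characters at -x, so polynomials must be approximated on the
    reflection of \<open>K\<close>.\<close>
  have "compact (uminus ` K)"
    using K(1) by (intro compact_continuous_image continuous_intros)
  then obtain N where N: "finite N" "N \<subseteq> poly ` trig_unit_ball E"
    "\<forall>q\<in>poly ` trig_unit_ball E. \<exists>q'\<in>N. \<forall>y\<in>uminus ` K. cmod (q y - q' y) \<le> 4 * \<eta>"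
  proof (rule equicontinuous_finite_net[where F = "poly ` trig_unit_ball E" and U = U and \<eta> = \<eta>, rotated 4])
    show "cmod (q y) \<le> 1" if "q \<in> poly ` trig_unit_ball E" for q y
      using that by (auto simp: poly_def trig_unit_ball_def)
    show "cmod (q (x + y) - q y) \<le> \<eta>" if "q \<in> poly ` trig_unit_ball E" "x \<in> U" for q x y
      using that U(3) by (auto simp: poly_def trig_unit_ball_def)
  qed (use U \<eta> in auto)
  obtain P where P: "finite P" "P \<subseteq> trig_unit_ball E" "N = poly ` P"
    using finite_subset_image[OF N(1,2)] by metis
  have "\<forall>p\<in>P. \<exists>C. compactin dual_top C \<and>
    (\<forall>\<gamma>\<in>characters - C. cmod (\<Sum>s\<in>fst p. snd p s * fourier_meas \<nu> h (\<lambda>x. s x * \<gamma> x)) \<le> \<epsilon> / 3)"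
  proof (intro ballI trig_sum_decay decay)
    fix p assume "p \<in> P"
    then have "p \<in> trig_unit_ball E" using P(2) by blast
    then show "finite (fst p)" "fst p \<subseteq> characters"
      using E(2) by (auto simp: trig_unit_ball_def)
  qed (use \<open>\<epsilon> > 0\<close> in simp)
  from bchoice[OF this] obtain C where C: "\<forall>p\<in>P. compactin dual_top (C p) \<and>
    (\<forall>\<gamma>\<in>characters - C p. cmod (\<Sum>s\<in>fst p. snd p s * fourier_meas \<nu> h (\<lambda>x. s x * \<gamma> x)) \<le> \<epsilon> / 3)"
    by blast
  show ?thesis
  proof (intro exI conjI ballI, safe)
    show "compactin dual_top (\<Union>(C ` P))" using P C by (intro compactin_Union) auto
    fix \<gamma> :: "'g \<Rightarrow> complex" and S c
    assume "\<gamma> \<in> characters" "\<gamma> \<notin> \<Union>(C ` P)" and Sc: "(S, c) \<in> trig_unit_ball E"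
    then have \<gamma>: "\<gamma> \<in> characters - \<Union>(C ` P)" by blast
    from Sc obtain p where p: "p \<in> P" "\<forall>y\<in>uminus ` K. cmod (poly (S, c) y - poly p y) \<le> 4 * \<eta>"
      using N(3) P(3) by blast
    have form: "(\<Sum>s\<in>fst p. snd p s * fourier_meas \<nu> h (\<lambda>x. s x * \<gamma> x))
        = (\<integral>x. poly p (- x) * (\<gamma> (- x) * h x) \<partial>\<nu>)" if "p \<in> trig_unit_ball E" for p
    proof -
      have "(\<Sum>s\<in>fst p. snd p s * fourier_meas \<nu> h (\<lambda>x. s x * \<gamma> x))
         = (\<Sum>s\<in>fst p. snd p s * fourier_meas \<nu> (\<lambda>x. \<gamma> (- x) * h x) s)"
        by (simp add: fourier_meas_def mult.assoc)
      also have "\<dots> = (\<integral>x. (\<Sum>s\<in>fst p. snd p s * s (- x)) * (\<gamma> (- x) * h x) \<partial>\<nu>)"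
        by (rule sum_fourier_meas) (use that E(2) \<gamma> integrable_fourier[OF sets h] in \<open>auto simp: trig_unit_ball_def sets\<close>)
      finally show ?thesis by (simp add: poly_def case_prod_beta)
    qed
    have meas: "(\<lambda>x. poly p (- x)) \<in> borel_measurable \<nu>" if "p \<in> trig_unit_ball E" for p
      using continuous_on_trig_poly_minus[of "fst p" UNIV "snd p" 0] that E(2)
      by (intro continuous_imp_measurable_borel_sets[OF sets]) (auto simp: poly_def case_prod_beta trig_unit_ball_def)
    have bd: "cmod (poly p y) \<le> 1" if "p \<in> trig_unit_ball E" for p y
      using that by (auto simp: poly_def trig_unit_ball_def)
    have pE: "p \<in> trig_unit_ball E" using p P(2) by blast
    let ?g = "\<lambda>x. poly (S, c) (- x) - poly p (- x)"
    have hg: "integrable \<nu> (\<lambda>x. \<gamma> (- x) * h x)" using integrable_fourier[OF sets h] \<gamma> by blast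
    have n: "cmod (\<gamma> (- x) * h x) = cmod (h x)" for x using \<gamma> by (simp add: norm_mult norm_character)
    have "cmod (\<integral>x. ?g x * (\<gamma> (- x) * h x) \<partial>\<nu>)
        \<le> 4 * \<eta> * (\<integral>x. cmod (\<gamma> (- x) * h x) \<partial>\<nu>) + 2 * (\<integral>x. indicator (- K) x * cmod (\<gamma> (- x) * h x) \<partial>\<nu>)"
    proof (rule integral_bounded_mult[OF hg])
      show "?g \<in> borel_measurable \<nu>" using meas[OF Sc] meas[OF pE] by simp
      show "cmod (?g x) \<le> 2" for x
        using norm_triangle_ineq4[of "poly (S, c) (- x)" "poly p (- x)"] bd[OF Sc, of "- x"] bd[OF pE, of "- x"] by linarith
      show "- K \<in> sets \<nu>" using borel_compact[OF K(1)] by (simp add: sets)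
      show "cmod (?g x) \<le> 4 * \<eta>" if "x \<notin> - K" for x using p(2) that by auto
    qed (use \<eta> in auto)
    also have "\<dots> \<le> \<epsilon> / 3 + \<epsilon> / 3" using \<eta>(2) K(2) by (simp add: n T_def)
    also have "(\<integral>x. ?g x * (\<gamma> (- x) * h x) \<partial>\<nu>) =
       (\<integral>x. poly (S, c) (- x) * (\<gamma> (- x) * h x) \<partial>\<nu>) - (\<integral>x. poly p (- x) * (\<gamma> (- x) * h x) \<partial>\<nu>)"
      unfolding left_diff_distrib
      by (intro Bochner_Integration.integral_diff integrable_bounded_mult[where B = 1, OF hg] meas Sc pE bd)
    finally have "cmod ((\<integral>x. poly (S, c) (- x) * (\<gamma> (- x) * h x) \<partial>\<nu>) - (\<integral>x. poly p (- x) * (\<gamma> (- x) * h x) \<partial>\<nu>)) \<le> 2 * (\<epsilon> / 3)"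
      by simp
    moreover have "cmod (\<integral>x. poly p (- x) * (\<gamma> (- x) * h x) \<partial>\<nu>) \<le> \<epsilon> / 3"
      using bspec[OF C p(1)] \<gamma> p(1) by (auto simp: form[OF pE, symmetric])
    ultimately have "cmod (\<integral>x. poly (S, c) (- x) * (\<gamma> (- x) * h x) \<partial>\<nu>) \<le> \<epsilon>"
      using norm_triangle_ineq[of "(\<integral>x. poly (S, c) (- x) * (\<gamma> (- x) * h x) \<partial>\<nu>) - (\<integral>x. poly p (- x) * (\<gamma> (- x) * h x) \<partial>\<nu>)" "\<integral>x. poly p (- x) * (\<gamma> (- x) * h x) \<partial>\<nu>"]
      by simp
    then show "cmod (\<Sum>s\<in>S. c s * fourier_meas \<nu> h (\<lambda>x. s x * \<gamma> x)) \<le> \<epsilon>"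
      using form[OF Sc] by simp
  qed
qed

text \<open>Factoring \<open>\<gamma>\<close> out of a polynomial preserves its modulus pointwise.
  Since \<open>\<gamma>\<close> has no zeros, frequencies correspond one to one and the coefficients
  can be carried over.\<close>

lemma trig_unit_ball_translate:
  assumes \<gamma>: "\<gamma> \<in> characters" and Sc: "(S, c) \<in> trig_unit_ball (dual_translate E \<gamma>)"
  obtains S' c' where "(S', c') \<in> trig_unit_ball E"
    "\<And>\<phi>. (\<Sum>s\<in>S. c s * \<phi> s) = (\<Sum>s\<in>S'. c' s * \<phi> (\<lambda>x. s x * \<gamma> x))"
proof -
  let ?t = "\<lambda>s x. s x * \<gamma> x"
  have S: "finite S" "S \<subseteq> ?t ` E" "\<And>x. cmod (\<Sum>s\<in>S. c s * s x) \<le> 1"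
    using Sc by (auto simp: trig_unit_ball_def dual_translate_def)
  have inj: "inj ?t"
  proof (rule injI)
    fix s t assume eq: "?t s = ?t t"
    have "\<gamma> x \<noteq> 0" for x using norm_character[OF \<gamma>, of x] by auto
    then show "s = t" using fun_cong[OF eq] by auto
  qed
  obtain S' where S': "S' \<subseteq> E" "finite S'" "S = ?t ` S'"
    using finite_subset_image[OF S(1,2)] by metis
  have sum: "(\<Sum>s\<in>S. c s * \<phi> s) = (\<Sum>s\<in>S'. c (?t s) * \<phi> (?t s))" for \<phi>
    unfolding S'(3) by (subst sum.reindex[OF inj_on_subset[OF inj]]) auto
  have "cmod (\<Sum>s\<in>S'. c (?t s) * s x) \<le> 1" for x
  proof -
    have "(\<Sum>s\<in>S'. c (?t s) * ?t s x) = (\<Sum>s\<in>S'. c (?t s) * s x) * \<gamma> x"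
      by (simp add: sum_distrib_right mult.assoc)
    then show ?thesis using S(3)[of x] sum[of "\<lambda>s. s x"]
      by (simp add: norm_mult norm_character[OF \<gamma>])
  qed
  then have "(S', \<lambda>s. c (?t s)) \<in> trig_unit_ball E" using S' by (simp add: trig_unit_ball_def)
  with sum that show thesis by blast
qed

lemma loc_norm_alt: "loc_norm E \<phi> = (SUP (S, c)\<in>trig_unit_ball E. cmod (\<Sum>s\<in>S. c s * \<phi> s))"
  unfolding loc_norm_def trig_unit_ball_def by (rule arg_cong[where f = Sup]) auto

lemma trig_unit_ball_empty: "({}, c) \<in> trig_unit_ball E"
  by (simp add: trig_unit_ball_def)

lemma loc_norm_le:
  assumes "\<And>S c. (S, c) \<in> trig_unit_ball E \<Longrightarrow> cmod (\<Sum>s\<in>S. c s * \<phi> s) \<le> B"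
  shows "loc_norm E \<phi> \<le> B"
  unfolding loc_norm_alt
proof (rule cSUP_least)
  show "trig_unit_ball E \<noteq> {}" using trig_unit_ball_empty by blast
qed (use assms in auto)

text \<open>A real \<open>Sup\<close> dominates its set only if the set is bounded above;
  \<open>B\<close> certifies this and does not appear in the conclusion.\<close>

lemma le_loc_norm:
  assumes "\<And>S c. (S, c) \<in> trig_unit_ball E \<Longrightarrow> cmod (\<Sum>s\<in>S. c s * \<phi> s) \<le> B"
    and "(S, c) \<in> trig_unit_ball E"
  shows "cmod (\<Sum>s\<in>S. c s * \<phi> s) \<le> loc_norm E \<phi>"
  unfolding loc_norm_alt
  by (rule cSUP_upper2[OF _ assms(2)]) (use assms(1) in \<open>auto intro!: bdd_aboveI[of _ B]\<close>)

text \<open>The uniform bound \<open>B\<close> makes both nested suprema genuine. The third claim is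
  the domination of the sup norm by the V-norm.\<close>

lemma Vnorm_bounds:
  fixes \<phi> :: "('g::topological_ab_group_add \<Rightarrow> complex) \<Rightarrow> complex"
  assumes B: "\<And>\<gamma> S c. \<gamma> \<in> characters \<Longrightarrow> (S, c) \<in> trig_unit_ball (dual_translate E \<gamma>) \<Longrightarrow> cmod (\<Sum>s\<in>S. c s * \<phi> s) \<le> B"
  shows "0 \<le> Vnorm E \<phi>" "Vnorm E \<phi> \<le> B"
    "\<And>\<gamma>. (\<lambda>x. 1) \<in> E \<Longrightarrow> \<gamma> \<in> characters \<Longrightarrow> cmod (\<phi> \<gamma>) \<le> Vnorm E \<phi>"
proof -
  have le: "Vnorm_at E \<phi> \<gamma> \<le> B" if "\<gamma> \<in> characters" for \<gamma>
    unfolding Vnorm_at_def by (rule loc_norm_le) (rule B[OF that])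
  then have bdd: "bdd_above (Vnorm_at E \<phi> ` characters)" by (auto intro!: bdd_aboveI[of _ B])
  show "Vnorm E \<phi> \<le> B"
    unfolding Vnorm_def using le one_character by (intro cSUP_least) auto
  have ge: "cmod (\<Sum>s\<in>S. c s * \<phi> s) \<le> Vnorm E \<phi>"
    if "\<gamma> \<in> characters" "(S, c) \<in> trig_unit_ball (dual_translate E \<gamma>)" for \<gamma> S c
  proof -
    have "cmod (\<Sum>s\<in>S. c s * \<phi> s) \<le> Vnorm_at E \<phi> \<gamma>"
      unfolding Vnorm_at_def by (rule le_loc_norm[OF B that(2)]) (rule that(1))
    also have "\<dots> \<le> Vnorm E \<phi>" unfolding Vnorm_def by (rule cSUP_upper[OF that(1) bdd])
    finally show ?thesis .
  qed
  show "0 \<le> Vnorm E \<phi>" using ge[OF one_character trig_unit_ball_empty] by simp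
  show "cmod (\<phi> \<gamma>) \<le> Vnorm E \<phi>" if "(\<lambda>x. 1) \<in> E" "\<gamma> \<in> characters" for \<gamma>
  proof -
    have "\<gamma> \<in> dual_translate E \<gamma>"
      unfolding dual_translate_def using that(1) by (rule rev_image_eqI) simp
    \<comment> \<open>The test polynomial is the character \<open>\<gamma>\<close> itself, which has
      sup norm 1 and belongs to the translate of \<open>E\<close> because the trivial character
      belongs to \<open>E\<close>.\<close>
    then have "({\<gamma>}, \<lambda>s. 1) \<in> trig_unit_ball (dual_translate E \<gamma>)"
      using norm_character[OF that(2)] by (simp add: trig_unit_ball_def)
    from ge[OF that(2) this] show ?thesis by simp
  qed
qed


section \<open>The Riemann--Lebesgue lemma\<close>

lemma haar_sets: "haar_measure H \<Longrightarrow> sets H = sets borel"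
  by (simp add: haar_measure_def)

lemma haar_emeasure_translate:
  "haar_measure H \<Longrightarrow> A \<in> sets H \<Longrightarrow> emeasure H ((+) a ` A) = emeasure H A"
  unfolding haar_measure_def by metis

lemma haar_outer:
  "haar_measure H \<Longrightarrow> A \<in> sets H \<Longrightarrow> emeasure H A = (INF U\<in>{U. A \<subseteq> U \<and> open U}. emeasure H U)"
  unfolding haar_measure_def by metis

lemma haar_inner:
  "haar_measure H \<Longrightarrow> open U \<Longrightarrow> emeasure H U = (SUP K\<in>{K. K \<subseteq> U \<and> compact K}. emeasure H K)"
  unfolding haar_measure_def by metis

lemma haar_measurable_add:
  fixes H :: "'g::topological_ab_group_add measure"
  assumes H: "haar_measure H"
  shows "(\<lambda>x. a + x) \<in> measurable H H"
proof -
  have "(\<lambda>x. a + x) \<in> borel_measurable H"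
    by (rule continuous_imp_measurable_borel_sets[OF haar_sets[OF H]]) (intro continuous_intros)
  then show ?thesis using measurable_cong_sets[OF refl haar_sets[OF H]] by blast
qed

lemma haar_distr:
  fixes H :: "'g::topological_ab_group_add measure"
  assumes H: "haar_measure H"
  shows "distr H H ((+) a) = H"
proof (rule measure_eqI)
  fix A assume "A \<in> sets (distr H H ((+) a))"
  then have A: "A \<in> sets H" by simp
  have m: "(+) a \<in> measurable H H" by (rule haar_measurable_add[OF H])
  have "(+) a -` A \<inter> space H = (+) (- a) ` A"
  proof (intro set_eqI iffI)
    fix x assume "x \<in> (+) a -` A \<inter> space H"
    then show "x \<in> (+) (- a) ` A" by (intro image_eqI[of _ _ "a + x"]) auto
  qed (auto simp: space_of_sets_borel[OF haar_sets[OF H]])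
  then show "emeasure (distr H H ((+) a)) A = emeasure H A"
    unfolding emeasure_distr[OF m A] using haar_emeasure_translate[OF H A, of "- a"] by (simp only:)
qed simp

lemma haar_integral_translate:
  fixes f :: "'g::topological_ab_group_add \<Rightarrow> 'b::{banach, second_countable_topology}"
  assumes H: "haar_measure H" and f: "f \<in> borel_measurable H"
  shows "(\<integral>x. f (a + x) \<partial>H) = (\<integral>x. f x \<partial>H)"
  using integral_distr[OF haar_measurable_add[OF H, of a] f] by (simp add: haar_distr[OF H])

lemma haar_integrable_translate:
  fixes f :: "'g::topological_ab_group_add \<Rightarrow> 'b::{banach, second_countable_topology}"
  assumes H: "haar_measure H" and f: "integrable H f"
  shows "integrable H (\<lambda>x. f (a + x))"
  using integrable_distr_eq[OF haar_measurable_add[OF H, of a], of f] f by (simp add: haar_distr[OF H])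

section \<open>Continuity of translation in L^1 and compact sets of characters\<close>

text \<open>The L^1 distance of the indicators of \<open>A\<close> and of its translate by
  \<open>t\<close>, that is, the L^1 modulus of continuity of the indicator of
  \<open>A\<close>.\<close>

definition translation_osc :: "'g::ab_group_add measure \<Rightarrow> 'g set \<Rightarrow> 'g \<Rightarrow> real" where
  "translation_osc H A t = (\<integral>x. \<bar>indicator A (x - t) - indicator A x\<bar> \<partial>H)"

lemma compact_subset_open_translate:
  fixes K U :: "'g::topological_ab_group_add set"
  assumes "compact K" "open U" "K \<subseteq> U"
  obtains W where "open W" "0 \<in> W" "\<forall>t\<in>W. \<forall>x\<in>K. t + x \<in> U"
proof -
  have "\<exists>T Q. open T \<and> open Q \<and> 0 \<in> T \<and> x \<in> Q \<and> (\<forall>t\<in>T. \<forall>y\<in>Q. t + y \<in> U)" if "x \<in> K" for x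
  proof -
    have "open ((\<lambda>p. fst p + snd p :: 'g) -` U)"
      by (intro open_vimage assms(2) continuous_intros)
    moreover have "(0, x) \<in> (\<lambda>p. fst p + snd p) -` U" using that assms(3) by auto
    ultimately obtain T Q where "open T" "open Q" "(0, x) \<in> T \<times> Q" "T \<times> Q \<subseteq> (\<lambda>p. fst p + snd p) -` U"
      by (rule open_prod_elim)
    then show ?thesis by (intro exI[of _ T] exI[of _ Q]) auto
  qed
  then have "\<forall>x\<in>K. \<exists>P. open (fst P) \<and> open (snd P) \<and> 0 \<in> fst P \<and> x \<in> snd P \<and> (\<forall>t\<in>fst P. \<forall>y\<in>snd P. t + y \<in> U)"
    by simp
  from bchoice[OF this] obtain P where P: "\<forall>x\<in>K. open (fst (P x)) \<and> open (snd (P x)) \<and> 0 \<in> fst (P x) \<and> x \<in> snd (P x)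
      \<and> (\<forall>t\<in>fst (P x). \<forall>y\<in>snd (P x). t + y \<in> U)" by blast
  then obtain X where X: "X \<subseteq> K" "finite X" "K \<subseteq> (\<Union>x\<in>X. snd (P x))"
    by (elim compactE_image[OF assms(1), of K "\<lambda>x. snd (P x)", rotated 2]) auto
  show thesis
  proof (rule that)
    show "open (\<Inter>x\<in>X. fst (P x))" using X P by (intro open_INT) auto
    show "0 \<in> (\<Inter>x\<in>X. fst (P x))" using X P by auto
    show "\<forall>t\<in>\<Inter>x\<in>X. fst (P x). \<forall>x\<in>K. t + x \<in> U"
    proof (intro ballI)
      fix t y assume t: "t \<in> (\<Inter>x\<in>X. fst (P x))" and "y \<in> K"
      then obtain x where "x \<in> X" "y \<in> snd (P x)" using X(3) by blast
      with t X(1) P show "t + y \<in> U" by blast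
    qed
  qed
qed

text \<open>Inner regularity of \<open>H\<close> is available for open sets only, so the compact
  \<open>K\<close> approximates an open \<open>U\<close> containing \<open>A\<close>, not
  \<open>A\<close> itself. For small \<open>t\<close> the translate of \<open>K\<close> by
  \<open>t\<close> stays in \<open>U\<close>, and this links the translate of \<open>A\<close> to
  \<open>A\<close>.\<close>

lemma translation_osc_small:
  fixes H :: "'g::{topological_ab_group_add, t2_space} measure"
  assumes H: "haar_measure H" and A: "A \<in> sets H" "emeasure H A < \<infinity>" and "e > 0"
  shows "\<exists>W. open W \<and> 0 \<in> W \<and> (\<forall>t\<in>W. translation_osc H A t < e)"
proof -
  note sets = haar_sets[OF H]
  define d where "d = e / 8"
  have d: "d > 0" using \<open>e > 0\<close> by (simp add: d_def)
  have outer: "emeasure H A = (INF U\<in>{U. A \<subseteq> U \<and> open U}. emeasure H U)"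
    by (rule haar_outer[OF H A(1)])
  have "emeasure H A < emeasure H A + ennreal d"
    using A(2) d by (simp add: ennreal_add_left_cancel_less)
  then have "(INF U\<in>{U. A \<subseteq> U \<and> open U}. emeasure H U) < emeasure H A + ennreal d"
    using outer by simp
  then obtain U where U: "A \<subseteq> U" "open U" "emeasure H U < emeasure H A + ennreal d"
    unfolding INF_less_iff by auto
  have Ufin: "emeasure H U < \<infinity>"
    using U(3) A(2) by (metis ennreal_add_less_top ennreal_less_top infinity_ennreal_def order.strict_trans)
  have Us: "U \<in> sets H" using U(2) sets by simp
  have mU: "measure H U < measure H A + d"
  proof -
    have "ennreal (measure H U) < ennreal (measure H A + d)"
      using U(3) A(2) Ufin d by (simp add: emeasure_eq_ennreal_measure less_top ennreal_plus)
    then show ?thesis using ennreal_less_iff[of "measure H U"] by simp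
  qed
  have inner: "emeasure H U = (SUP K\<in>{K. K \<subseteq> U \<and> compact K}. emeasure H K)"
    by (rule haar_inner[OF H U(2)])
  have "\<exists>K. K \<subseteq> U \<and> compact K \<and> measure H U - d < measure H K"
  proof (cases "measure H U < d")
    case True
    then show ?thesis by (intro exI[of _ "{}"]) simp
  next
    case False
    have "ennreal (measure H U - d) < ennreal (measure H U)"
      using d False by (intro ennreal_lessI) linarith+
    also have "\<dots> = (SUP K\<in>{K. K \<subseteq> U \<and> compact K}. emeasure H K)"
      unfolding inner[symmetric] using Ufin by (simp add: emeasure_eq_ennreal_measure less_top)
    finally obtain K where K: "K \<subseteq> U" "compact K" "ennreal (measure H U - d) < emeasure H K"
      unfolding less_SUP_iff by auto
    have "emeasure H K < \<infinity>" using emeasure_mono[OF K(1) Us] Ufin by (rule order.strict_trans1)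
    then have "measure H U - d < measure H K"
      using K(3) False by (simp add: emeasure_eq_ennreal_measure less_top ennreal_less_iff)
    with K show ?thesis by blast
  qed
  then obtain K where K: "K \<subseteq> U" "compact K" "measure H U - d < measure H K" by blast
  have Kfin: "emeasure H K < \<infinity>" using emeasure_mono[OF K(1) Us] Ufin by (rule order.strict_trans1)
  have Ks: "K \<in> sets H" using borel_compact[OF K(2)] sets by simp
  obtain W where W: "open W" "0 \<in> W" "\<forall>t\<in>W. \<forall>x\<in>K. t + x \<in> U"
    using compact_subset_open_translate[OF K(2) U(2) K(1)] .
  have int: "integrable H (indicator B :: 'g \<Rightarrow> real)" if "B \<in> sets H" "emeasure H B < \<infinity>" for B
    using that by simp
  have shift: "indicator B (x - t) = indicator B (- t + x)" for B and x t :: 'g by simp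
  have int_shift: "integrable H (\<lambda>x. indicator B (x - t) :: real)" if "B \<in> sets H" "emeasure H B < \<infinity>" for B t
    unfolding shift by (rule haar_integrable_translate[OF H int[OF that]])
  have val: "(\<integral>x. indicator B x \<partial>H) = measure H B" if "B \<in> sets H" for B
    using that by (simp add: space_of_sets_borel[OF sets])
  have val_shift: "(\<integral>x. indicator B (x - t) \<partial>H) = measure H B" if "B \<in> sets H" for B t
    unfolding shift using val[OF that] that
    by (subst haar_integral_translate[OF H]) auto
  have "translation_osc H A t < e" if t: "t \<in> W" for t
  proof -
    \<comment> \<open>The chain goes from the translate of \<open>A\<close> to those of
      \<open>U\<close> and \<open>K\<close>, then to \<open>U\<close> and to \<open>A\<close>. Every
      link is a nonnegative difference with integral below \<open>d\<close> = \<open>e\<close> / 8,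
      so the total is below \<open>e\<close> / 2.\<close>
    let ?R = "\<lambda>x. (indicator U (x - t) - indicator A (x - t)) + (indicator U (x - t) - indicator K (x - t))
        + (indicator U x - indicator K (x - t)) + (indicator U x - indicator A x) :: real"
    have "translation_osc H A t \<le> (\<integral>x. ?R x \<partial>H)"
      unfolding translation_osc_def
    proof (rule integral_mono)
      show "integrable H (\<lambda>x. \<bar>indicator A (x - t) - indicator A x\<bar> :: real)"
        by (intro integrable_abs Bochner_Integration.integrable_diff int_shift int A)
      show "integrable H ?R"
        by (intro Bochner_Integration.integrable_add Bochner_Integration.integrable_diff int_shift int A Us Ks Ufin Kfin)
      fix x
      have "x - t \<in> A \<Longrightarrow> x - t \<in> U" "x - t \<in> K \<Longrightarrow> x - t \<in> U" "x \<in> A \<Longrightarrow> x \<in> U"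
        using U(1) K(1) by auto
      moreover have "x - t \<in> K \<Longrightarrow> x \<in> U" using W(3) t by force
      ultimately show "\<bar>indicator A (x - t) - indicator A x\<bar> \<le> ?R x"
        by (auto split: split_indicator)
    qed
    also have "\<dots> = (measure H U - measure H A) + (measure H U - measure H K) + (measure H U - measure H K) + (measure H U - measure H A)"
    proof (rule has_bochner_integral_integral_eq)
      have hb: "has_bochner_integral H (\<lambda>x. indicator B x :: real) (measure H B)"
        "has_bochner_integral H (\<lambda>x. indicator B (x - t) :: real) (measure H B)"
        if "B \<in> sets H" "emeasure H B < \<infinity>" for B
        unfolding has_bochner_integral_iff using that by (blast intro: int int_shift val val_shift)+
      show "has_bochner_integral H ?R ((measure H U - measure H A) + (measure H U - measure H K)
          + (measure H U - measure H K) + (measure H U - measure H A))"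
        by (intro has_bochner_integral_add has_bochner_integral_diff hb A Us Ks Ufin Kfin)
    qed
    also have "\<dots> < e" using mU K(3) \<open>e > 0\<close> unfolding d_def by linarith
    finally show ?thesis .
  qed
  with W show ?thesis by blast
qed

text \<open>Domination by \<open>\<omega>\<close> forces equicontinuity, so on this set the compact-open topology is the
  topology of pointwise convergence and Tychonoff's theorem applies.\<close>

lemma compactin_dominated_characters:
  fixes \<omega> :: "'g::topological_ab_group_add \<Rightarrow> real"
  assumes \<omega>: "\<And>d. d > 0 \<Longrightarrow> \<exists>U. open U \<and> 0 \<in> U \<and> (\<forall>t\<in>U. \<omega> t < d)"
  shows "compactin dual_top {\<gamma> \<in> characters. \<forall>t. cmod (\<gamma> t - 1) \<le> \<omega> t}"
proof -
  \<comment> \<open>Continuity is omitted here because domination by \<open>\<omega>\<close> implies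
    it; what remains are conditions on coordinates, closed in the product topology.\<close>
  let ?B = "{f :: 'g \<Rightarrow> complex. (\<forall>x. cmod (f x) = 1) \<and> (\<forall>x y. f (x + y) = f x * f y) \<and> (\<forall>t. cmod (f t - 1) \<le> \<omega> t)}"
  have diff: "cmod (f y - f x) \<le> \<omega> (y - x)" if "f \<in> ?B" for f x y
  proof -
    have "f (x + (y - x)) = f x * f (y - x)" using that by blast
    then have "f y = f x * f (y - x)" by simp
    then have "f y - f x = f x * (f (y - x) - 1)" by (simp add: algebra_simps)
    then show ?thesis using that by (simp add: norm_mult)
  qed
  have cont: "continuous_on UNIV f" if f: "f \<in> ?B" for f
    unfolding continuous_on_def
  proof (intro ballI tendstoI)
    fix x and e :: real assume "e > 0"
    then obtain U where U: "open U" "0 \<in> U" "\<forall>t\<in>U. \<omega> t < e" using \<omega> by blast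
    have "open ((\<lambda>y. y - x) -` U)" by (intro open_vimage U continuous_intros)
    then have "\<forall>\<^sub>F y in nhds x. y \<in> (\<lambda>y. y - x) -` U"
      using U(2) by (intro eventually_nhds_in_open) auto
    then have "\<forall>\<^sub>F y in at x. y \<in> (\<lambda>y. y - x) -` U" by (simp add: eventually_at_filter eventually_mono)
    then show "\<forall>\<^sub>F y in at x. dist (f y) (f x) < e"
    proof eventually_elim
      case (elim y)
      then have "\<omega> (y - x) < e" using U(3) by auto
      then show ?case using diff[OF f, of y x] unfolding dist_norm by linarith
    qed
  qed
  have eq: "{\<gamma> \<in> characters. \<forall>t. cmod (\<gamma> t - 1) \<le> \<omega> t} = ?B"
    using cont by (auto simp: characters_def)
  have co: "continuous_on UNIV (\<lambda>f :: 'g \<Rightarrow> complex. f x)" for x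
    by (rule continuous_on_product_coordinates)
  have "compactin (product_topology (\<lambda>_. euclidean) UNIV) (PiE UNIV (\<lambda>_ :: 'g. cball (0::complex) 1))"
    by (subst compactin_PiE) auto
  then have "compact (PiE UNIV (\<lambda>_ :: 'g. cball (0::complex) 1))"
    by (simp add: euclidean_product_topology flip: compactin_euclidean_iff)
  moreover have "closed ?B"
    by (intro closed_Collect_conj closed_Collect_all closed_Collect_eq closed_Collect_le continuous_intros co)
  ultimately have "compact (PiE UNIV (\<lambda>_ :: 'g. cball (0::complex) 1) \<inter> ?B)"
    by (intro compact_Int_closed)
  also have "PiE UNIV (\<lambda>_. cball 0 1) \<inter> ?B = ?B" by (auto simp: PiE_def)
  finally have comp: "compact ?B" .
  have "continuous_map (top_of_set ?B) dual_top (\<lambda>f. f)"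
  proof (rule continuous_map_into_dual_top)
    show "(\<lambda>f. f) \<in> topspace (top_of_set ?B) \<rightarrow> characters" using eq by auto
    fix K :: "'g set" and \<gamma>0 :: "'g \<Rightarrow> complex" and e :: real
    assume K: "compact K" and \<gamma>0: "\<gamma>0 \<in> characters" and e: "e > 0"
    let ?S = "{f \<in> topspace (top_of_set ?B). \<forall>x\<in>K. cmod (f x - \<gamma>0 x) < e}"
    show "openin (top_of_set ?B) ?S"
    proof (subst openin_subopen, intro ballI)
      fix f1 assume "f1 \<in> ?S"
      then have f1: "f1 \<in> ?B" "\<forall>x\<in>K. cmod (f1 x - \<gamma>0 x) < e" by auto
      \<comment> \<open>Compactness of \<open>K\<close> turns the strict inequality into a gap
        between \<open>e'\<close> and \<open>e\<close>, a quarter of which is the tolerance for each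
        of three errors. For empty \<open>K\<close> any \<open>e'\<close> below \<open>e\<close>
        will do.\<close>
      obtain e' where e': "e' < e" "\<forall>x\<in>K. cmod (f1 x - \<gamma>0 x) \<le> e'"
      proof (cases "K = {}")
        case False
        have "continuous_on K (\<lambda>x. cmod (f1 x - \<gamma>0 x))"
          by (intro continuous_intros continuous_character[OF \<gamma>0] continuous_on_subset[OF cont[OF f1(1)]]) auto
        from continuous_attains_sup[OF K False this] show thesis using f1(2) that by blast
      qed (use that[of "e - 1"] in auto)
      define d where "d = (e - e') / 4"
      have d: "d > 0" using e' by (simp add: d_def)
      then obtain U where U: "open U" "0 \<in> U" "\<forall>t\<in>U. \<omega> t < d" using \<omega> by blast
      obtain X where X: "finite X" "X \<subseteq> K" "\<forall>y\<in>K. \<exists>x\<in>X. y - x \<in> U"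
        using compact_group_cover[OF K U(1,2)] .
      let ?T = "?B \<inter> (\<Inter>x\<in>X. {f. cmod (f x - f1 x) < d})"
      show "\<exists>T. openin (top_of_set ?B) T \<and> f1 \<in> T \<and> T \<subseteq> ?S"
      proof (intro exI conjI)
        have "open (\<Inter>x\<in>X. {f. cmod (f x - f1 x) < d})"
          using X(1) by (intro open_INT ballI open_Collect_less continuous_intros co) auto
        then show "openin (top_of_set ?B) ?T" by (rule openin_open_Int)
        show "f1 \<in> ?T" using f1 d by auto
        show "?T \<subseteq> ?S"
        proof
          fix f assume f: "f \<in> ?T"
          have "cmod (f y - \<gamma>0 y) < e" if y: "y \<in> K" for y
          proof -
            obtain x where x: "x \<in> X" "y - x \<in> U" using X(3) y by blast
            have w: "\<omega> (y - x) < d" using U(3) x(2) by blast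
            have "f \<in> ?B" using f by blast
            from diff[OF this, of y x] w have 1: "cmod (f y - f x) < d" by linarith
            from diff[OF f1(1), of y x] w have 2: "cmod (f1 y - f1 x) < d" by linarith
            have 3: "cmod (f x - f1 x) < d" using f x(1) by auto
            have 4: "cmod (f1 y - \<gamma>0 y) \<le> e'" using e'(2) y by blast
            have "f y - \<gamma>0 y = ((f y - f x) + (f x - f1 x)) + ((f1 y - \<gamma>0 y) - (f1 y - f1 x))" by simp
            then have "cmod (f y - \<gamma>0 y) \<le> (cmod (f y - f x) + cmod (f x - f1 x)) + (cmod (f1 y - \<gamma>0 y) + cmod (f1 y - f1 x))"
              by (simp only:) (intro norm_triangle_le norm_triangle_le_diff add_mono norm_triangle_ineq norm_triangle_ineq4)
            also have "\<dots> < 4 * d + e'" using 1 2 3 4 d by linarith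
            also have "\<dots> = e" by (simp add: d_def field_simps)
            finally show ?thesis .
          qed
          then show "f \<in> ?S" using f by auto
        qed
      qed
    qed
  qed
  moreover have "compactin (top_of_set ?B) ?B"
    using comp by (simp add: compactin_subtopology)
  ultimately have "compactin dual_top ((\<lambda>f. f) ` ?B)" by (rule image_compactin[rotated])
  then show ?thesis unfolding eq by simp
qed

lemma dual_decay_add:
  assumes "dual_decay \<phi>" "dual_decay \<psi>"
  shows "dual_decay (\<lambda>\<gamma>. \<phi> \<gamma> + \<psi> \<gamma>)"
  unfolding dual_decay_def
proof (intro allI impI)
  fix e :: real assume "e > 0"
  then have e: "e / 2 > 0" by simp
  obtain K L where K: "compactin dual_top K" "\<forall>\<gamma>\<in>characters - K. cmod (\<phi> \<gamma>) < e / 2"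
    and L: "compactin dual_top L" "\<forall>\<gamma>\<in>characters - L. cmod (\<psi> \<gamma>) < e / 2"
    using assms e unfolding dual_decay_def by blast
  show "\<exists>K. compactin dual_top K \<and> (\<forall>\<gamma>\<in>characters - K. cmod (\<phi> \<gamma> + \<psi> \<gamma>) < e)"
  proof (intro exI conjI ballI)
    show "compactin dual_top (K \<union> L)" using K L by (intro compactin_Un)
    fix \<gamma> assume "\<gamma> \<in> characters - (K \<union> L)"
    then have "cmod (\<phi> \<gamma>) < e / 2" "cmod (\<psi> \<gamma>) < e / 2" using K(2) L(2) by auto
    then show "cmod (\<phi> \<gamma> + \<psi> \<gamma>) < e" using norm_triangle_ineq[of "\<phi> \<gamma>" "\<psi> \<gamma>"] by linarith
  qed
qed

lemma dual_decay_scale: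
  assumes "dual_decay \<phi>"
  shows "dual_decay (\<lambda>\<gamma>. a * \<phi> \<gamma>)"
  unfolding dual_decay_def
proof (intro allI impI)
  fix e :: real assume "e > 0"
  then have e: "e / (cmod a + 1) > 0" by (simp add: add_nonneg_pos)
  obtain K where K: "compactin dual_top K" "\<forall>\<gamma>\<in>characters - K. cmod (\<phi> \<gamma>) < e / (cmod a + 1)"
    using assms e unfolding dual_decay_def by blast
  have "cmod (a * \<phi> \<gamma>) < e" if "\<gamma> \<in> characters - K" for \<gamma>
  proof -
    have "cmod a * cmod (\<phi> \<gamma>) \<le> (cmod a + 1) * cmod (\<phi> \<gamma>)" by (simp add: mult_right_mono)
    also have "\<dots> < (cmod a + 1) * (e / (cmod a + 1))"
      using K(2) that by (intro mult_strict_left_mono) (auto simp: add_nonneg_pos)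
    also have "\<dots> = e" by (simp add: add_nonneg_eq_0_iff)
    finally show ?thesis by (simp add: norm_mult)
  qed
  with K(1) show "\<exists>K. compactin dual_top K \<and> (\<forall>\<gamma>\<in>characters - K. cmod (a * \<phi> \<gamma>) < e)" by blast
qed

lemma dual_decay_uniform_limit:
  assumes "\<And>e. e > 0 \<Longrightarrow> \<exists>\<psi>. dual_decay \<psi> \<and> (\<forall>\<gamma>\<in>characters. cmod (\<phi> \<gamma> - \<psi> \<gamma>) < e)"
  shows "dual_decay \<phi>"
  unfolding dual_decay_def
proof (intro allI impI)
  fix e :: real assume "e > 0"
  then have e: "e / 2 > 0" by simp
  obtain \<psi> where \<psi>: "dual_decay \<psi>" "\<forall>\<gamma>\<in>characters. cmod (\<phi> \<gamma> - \<psi> \<gamma>) < e / 2"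
    using assms[OF e] by blast
  obtain K where K: "compactin dual_top K" "\<forall>\<gamma>\<in>characters - K. cmod (\<psi> \<gamma>) < e / 2"
    using \<psi>(1) e unfolding dual_decay_def by blast
  have "cmod (\<phi> \<gamma>) < e" if "\<gamma> \<in> characters - K" for \<gamma>
  proof -
    have "cmod (\<phi> \<gamma> - \<psi> \<gamma>) < e / 2" "cmod (\<psi> \<gamma>) < e / 2" using \<psi>(2) K(2) that by auto
    then show ?thesis using norm_triangle_ineq[of "\<phi> \<gamma> - \<psi> \<gamma>" "\<psi> \<gamma>"] by simp
  qed
  with K(1) show "\<exists>K. compactin dual_top K \<and> (\<forall>\<gamma>\<in>characters - K. cmod (\<phi> \<gamma>) < e)" by blast
qed

lemma fourier_indicator_translate:
  fixes H :: "'g::{topological_ab_group_add, t2_space} measure"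
  assumes H: "haar_measure H" and A: "A \<in> sets H" and \<gamma>: "\<gamma> \<in> characters"
  shows "fourier_meas H (\<lambda>x. indicator A (x - t)) \<gamma> = \<gamma> (- t) * fourier_meas H (indicator A) \<gamma>"
proof -
  note sets = haar_sets[OF H]
  have m: "(\<lambda>x. \<gamma> (- x)) \<in> borel_measurable H"
    using continuous_on_character_minus[OF \<gamma>, of UNIV 0] by (intro continuous_imp_measurable_borel_sets[OF sets]) simp
  have "(\<lambda>x. - t + x) \<in> measurable H H" by (rule haar_measurable_add[OF H])
  then have "(\<lambda>x. indicator A (- t + x) :: complex) \<in> borel_measurable H"
    by (rule measurable_compose) (use A in simp)
  then have "(\<lambda>x. \<gamma> (- x) * indicator A (x - t)) \<in> borel_measurable H"
    using m by simp
  then have "(\<integral>x. \<gamma> (- x) * indicator A (x - t) \<partial>H) = (\<integral>x. \<gamma> (- (t + x)) * indicator A (t + x - t) \<partial>H)"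
    by (rule haar_integral_translate[OF H, symmetric])
  also have "\<dots> = (\<integral>x. \<gamma> (- t) * (\<gamma> (- x) * indicator A x) \<partial>H)"
  proof (intro Bochner_Integration.integral_cong refl)
    fix x
    have "\<gamma> (- (t + x)) = \<gamma> (- t) * \<gamma> (- x)"
      using character_add[OF \<gamma>, of "- t" "- x"] by simp
    then show "\<gamma> (- (t + x)) * indicator A (t + x - t) = \<gamma> (- t) * (\<gamma> (- x) * indicator A x)"
      by (simp add: mult.assoc)
  qed
  finally show ?thesis by (simp add: fourier_meas_def)
qed

text \<open>Translating \<open>A\<close> multiplies the transform by a character value, so the
  transform of the difference of the two indicators carries the factor
  \<open>\<gamma> (- t) - 1\<close>; its modulus is at most the L^1 norm of that difference.\<close>

lemma fourier_indicator_bound: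
  fixes H :: "'g::{topological_ab_group_add, t2_space} measure"
  assumes H: "haar_measure H" and A: "A \<in> sets H" "emeasure H A < \<infinity>" and \<gamma>: "\<gamma> \<in> characters"
  shows "cmod (\<gamma> t - 1) * cmod (fourier_meas H (indicator A) \<gamma>) \<le> translation_osc H A t"
proof -
  note sets = haar_sets[OF H]
  have i: "integrable H (indicator A :: 'g \<Rightarrow> complex)"
  proof -
    have "integrable H (\<lambda>x. of_real (indicator A x) :: complex)"
      using A by (intro integrable_of_real) simp
    then show ?thesis by (simp add: of_real_indicator)
  qed
  have it: "integrable H (\<lambda>x. indicator A (x - t) :: complex)"
    using haar_integrable_translate[OF H i, of "- t"] by simp
  have "\<gamma> (- t) * fourier_meas H (indicator A) \<gamma> - fourier_meas H (indicator A) \<gamma>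
     = (\<integral>x. \<gamma> (- x) * indicator A (x - t) - \<gamma> (- x) * indicator A x \<partial>H)"
    unfolding fourier_indicator_translate[OF H A(1) \<gamma>, symmetric] unfolding fourier_meas_def
    by (rule Bochner_Integration.integral_diff[symmetric]; rule integrable_fourier[OF sets _ \<gamma>]; fact)
  then have "(\<gamma> (- t) - 1) * fourier_meas H (indicator A) \<gamma>
     = (\<integral>x. \<gamma> (- x) * indicator A (x - t) - \<gamma> (- x) * indicator A x \<partial>H)"
    by (simp add: algebra_simps)
  then have "cmod (\<gamma> (- t) - 1) * cmod (fourier_meas H (indicator A) \<gamma>)
      \<le> (\<integral>x. cmod (\<gamma> (- x) * indicator A (x - t) - \<gamma> (- x) * indicator A x) \<partial>H)"
    unfolding norm_mult[symmetric] by (simp only: integral_norm_bound)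
  also have "\<dots> = translation_osc H A t"
    unfolding translation_osc_def
    by (intro Bochner_Integration.integral_cong refl)
       (auto simp: norm_character[OF \<gamma>] split: split_indicator)
  also have "cmod (\<gamma> (- t) - 1) = cmod (\<gamma> t - 1)"
    unfolding character_minus[OF \<gamma>] by (metis complex_cnj_diff complex_cnj_one complex_mod_cnj)
  finally show ?thesis .
qed

text \<open>Where the transform is at least \<open>e\<close>, \<open>fourier_indicator_bound\<close>
  dominates \<open>\<gamma> t - 1\<close> by the modulus divided by \<open>e\<close>, which tends to
  0 with \<open>t\<close>. All such characters lie in one compact set.\<close>

lemma dual_decay_fourier_indicator:
  fixes H :: "'g::{topological_ab_group_add, t2_space} measure"
  assumes H: "haar_measure H" and A: "A \<in> sets H" "emeasure H A < \<infinity>"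
  shows "dual_decay (fourier_meas H (indicator A))"
  unfolding dual_decay_def
proof (intro allI impI)
  fix e :: real assume e: "e > 0"
  let ?K = "{\<gamma> \<in> characters. \<forall>t. cmod (\<gamma> t - 1) \<le> translation_osc H A t / e}"
  have "compactin dual_top ?K"
  proof (rule compactin_dominated_characters)
    fix d :: real assume "d > 0"
    then obtain W where "open W" "0 \<in> W" "\<forall>t\<in>W. translation_osc H A t < d * e"
      using translation_osc_small[OF H A, of "d * e"] e by auto
    then show "\<exists>U. open U \<and> 0 \<in> U \<and> (\<forall>t\<in>U. translation_osc H A t / e < d)"
      using e by (intro exI[of _ W]) (auto simp: divide_less_eq)
  qed
  moreover have "cmod (fourier_meas H (indicator A) \<gamma>) < e" if \<gamma>: "\<gamma> \<in> characters - ?K" for \<gamma>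
  proof (rule ccontr)
    assume "\<not> cmod (fourier_meas H (indicator A) \<gamma>) < e"
    then have "cmod (\<gamma> t - 1) * e \<le> cmod (\<gamma> t - 1) * cmod (fourier_meas H (indicator A) \<gamma>)" for t
      by (intro mult_left_mono) auto
    also have "cmod (\<gamma> t - 1) * cmod (fourier_meas H (indicator A) \<gamma>) \<le> translation_osc H A t" for t
      using \<gamma> by (intro fourier_indicator_bound[OF H A]) auto
    finally have "cmod (\<gamma> t - 1) \<le> translation_osc H A t / e" for t using e by (simp add: le_divide_eq)
    with \<gamma> show False by blast
  qed
  ultimately show "\<exists>K. compactin dual_top K \<and> (\<forall>\<gamma>\<in>characters - K. cmod (fourier_meas H (indicator A) \<gamma>) < e)"
    by blast
qed

theorem riemann_lebesgue:
  fixes H :: "'g::{topological_ab_group_add, t2_space} measure" and f :: "'g \<Rightarrow> complex"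
  assumes H: "haar_measure H" and f: "integrable H f"
  shows "dual_decay (fourier_meas H f)"
  using f
proof (induction rule: integrable_induct)
  case (base A c)
  have "fourier_meas H (\<lambda>x. indicator A x *\<^sub>R c) = (\<lambda>\<gamma>. c * fourier_meas H (indicator A) \<gamma>)"
  proof
    fix \<gamma>
    have "(\<integral>x. \<gamma> (- x) * (indicator A x *\<^sub>R c) \<partial>H) = (\<integral>x. c * (\<gamma> (- x) * indicator A x) \<partial>H)"
      by (intro Bochner_Integration.integral_cong refl) (auto split: split_indicator)
    then show "fourier_meas H (\<lambda>x. indicator A x *\<^sub>R c) \<gamma> = c * fourier_meas H (indicator A) \<gamma>"
      by (simp add: fourier_meas_def)
  qed
  then show ?case using dual_decay_scale[OF dual_decay_fourier_indicator[OF H base]] by simp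
next
  case (add f g)
  note i = integrable_fourier[OF haar_sets[OF H]]
  show ?case
  \<comment> \<open>Additivity of the transform is established at characters only, where the
    integrands are integrable. The limit lemma compares functions just there and so turns this
    partial equality into decay.\<close>
  proof (rule dual_decay_uniform_limit, intro exI conjI ballI)
    show "dual_decay (\<lambda>\<gamma>. fourier_meas H f \<gamma> + fourier_meas H g \<gamma>)"
      using add by (intro dual_decay_add)
    fix e :: real and \<gamma> :: "'g \<Rightarrow> complex" assume "e > 0" and \<gamma>: "\<gamma> \<in> characters"
    have "fourier_meas H (\<lambda>x. f x + g x) \<gamma> = fourier_meas H f \<gamma> + fourier_meas H g \<gamma>"
      unfolding fourier_meas_def distrib_left
      by (rule Bochner_Integration.integral_add; rule i[OF _ \<gamma>]; fact)
    then show "cmod (fourier_meas H (\<lambda>x. f x + g x) \<gamma> - (fourier_meas H f \<gamma> + fourier_meas H g \<gamma>)) < e"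
      using \<open>e > 0\<close> by simp
  qed
next
  case (lim f s)
  note i = integrable_fourier[OF haar_sets[OF H]]
  show ?case
  proof (rule dual_decay_uniform_limit)
    fix e :: real assume "e > 0"
    have "(\<lambda>n. \<integral>x. cmod (f x - s n x) \<partial>H) \<longlonglongrightarrow> (\<integral>x. 0 \<partial>H)"
    \<comment> \<open>The induction rule supplies approximants of modulus at most 2
      \<open>cmod (f x)\<close>, whence the factor 3.\<close>
    proof (rule integral_dominated_convergence[where w = "\<lambda>x. 3 * cmod (f x)"])
      show "integrable H (\<lambda>x. 3 * cmod (f x))" using lim by simp
      show "AE x in H. (\<lambda>n. cmod (f x - s n x)) \<longlonglongrightarrow> 0"
      proof (rule AE_I2)
        fix x assume "x \<in> space H"
        from tendsto_norm[OF tendsto_diff[OF tendsto_const[of "f x"] lim.hyps(2)[OF this]]]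
        show "(\<lambda>n. cmod (f x - s n x)) \<longlonglongrightarrow> 0" by simp
      qed
      show "AE x in H. norm (cmod (f x - s n x)) \<le> 3 * cmod (f x)" for n
      proof (rule AE_I2)
        fix x assume "x \<in> space H"
        from lim.hyps(3)[OF this, of n] show "norm (cmod (f x - s n x)) \<le> 3 * cmod (f x)"
          using norm_triangle_ineq4[of "f x" "s n x"] by simp
      qed
    qed (use lim in auto)
    then have "\<forall>\<^sub>F n in sequentially. (\<integral>x. cmod (f x - s n x) \<partial>H) < e"
      using \<open>e > 0\<close> by (intro order_tendstoD(2)) auto
    then obtain n where n: "(\<integral>x. cmod (f x - s n x) \<partial>H) < e"
      by (metis (no_types, lifting) eventually_sequentially order_refl)
    have "cmod (fourier_meas H f \<gamma> - fourier_meas H (s n) \<gamma>) < e" if \<gamma>: "\<gamma> \<in> characters" for \<gamma>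
    proof -
      have "fourier_meas H f \<gamma> - fourier_meas H (s n) \<gamma> = (\<integral>x. \<gamma> (- x) * f x - \<gamma> (- x) * s n x \<partial>H)"
        unfolding fourier_meas_def
        by (rule Bochner_Integration.integral_diff[symmetric]; rule i[OF _ \<gamma>]; rule lim.hyps)
      then have "cmod (fourier_meas H f \<gamma> - fourier_meas H (s n) \<gamma>) \<le> (\<integral>x. cmod (\<gamma> (- x) * f x - \<gamma> (- x) * s n x) \<partial>H)"
        by (simp only: integral_norm_bound)
      also have "\<dots> = (\<integral>x. cmod (f x - s n x) \<partial>H)"
        by (simp add: norm_mult norm_character[OF \<gamma>] flip: right_diff_distrib)
      finally show ?thesis using n by linarith
    qed
    then show "\<exists>\<psi>. dual_decay \<psi> \<and> (\<forall>\<gamma>\<in>characters. cmod (fourier_meas H f \<gamma> - \<psi> \<gamma>) < e)"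
      using lim.IH[of n] by blast
  qed
qed

text \<open>By tightness only a compact \<open>K\<close> matters, and closeness of characters on the
  reflection of \<open>K\<close> is a basic neighbourhood in the dual.\<close>

theorem continuous_map_fourier_meas:
  fixes \<nu> :: "'g::{topological_ab_group_add, t2_space} measure"
  assumes M: "in_M \<nu> h"
  shows "continuous_map dual_top euclidean (fourier_meas \<nu> h)"
proof -
  have h: "integrable \<nu> h" and sets: "sets \<nu> = sets borel"
    using M by (auto simp: in_M_def finite_radon_def)
  define T where "T = (\<integral>x. cmod (h x) \<partial>\<nu>)"
  have T: "T \<ge> 0" by (simp add: T_def)
  have near: "\<exists>N. openin dual_top N \<and> \<gamma>0 \<in> N \<and> (\<forall>\<gamma>\<in>N. cmod (fourier_meas \<nu> h \<gamma> - fourier_meas \<nu> h \<gamma>0) < e)"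
    if \<gamma>0: "\<gamma>0 \<in> characters" and e: "e > 0" for \<gamma>0 e
  proof -
    obtain K where K: "compact K" "(\<integral>x. indicator (- K) x * cmod (h x) \<partial>\<nu>) < e / 4"
      using in_M_tight[OF M, of "e / 4"] e by auto
    define \<delta> where "\<delta> = e / (2 * (T + 1))"
    have \<delta>: "\<delta> > 0" "\<delta> * T \<le> e / 2" using T e by (auto simp: \<delta>_def field_simps)
    have cK: "compact (uminus ` K)"
      using K(1) by (intro compact_continuous_image continuous_intros)
    let ?N = "{\<gamma> \<in> characters. \<forall>x\<in>uminus ` K. cmod (\<gamma> x - \<gamma>0 x) < \<delta>}"
    have "cmod (fourier_meas \<nu> h \<gamma> - fourier_meas \<nu> h \<gamma>0) < e" if \<gamma>: "\<gamma> \<in> ?N" for \<gamma>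
    proof -
      have \<gamma>c: "\<gamma> \<in> characters" using \<gamma> by simp
      have m: "(\<lambda>x. \<gamma> (- x)) \<in> borel_measurable \<nu>" if "\<gamma> \<in> characters" for \<gamma>
        using continuous_on_character_minus[OF that, of UNIV 0] by (intro continuous_imp_measurable_borel_sets[OF sets]) simp
      have "cmod (\<integral>x. (\<gamma> (- x) - \<gamma>0 (- x)) * h x \<partial>\<nu>) \<le> \<delta> * (\<integral>x. cmod (h x) \<partial>\<nu>) + 2 * (\<integral>x. indicator (- K) x * cmod (h x) \<partial>\<nu>)"
      proof (rule integral_bounded_mult[OF h])
        show "(\<lambda>x. \<gamma> (- x) - \<gamma>0 (- x)) \<in> borel_measurable \<nu>" using m \<gamma>c \<gamma>0 by simp
        show "cmod (\<gamma> (- x) - \<gamma>0 (- x)) \<le> 2" for x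
          using norm_triangle_ineq4[of "\<gamma> (- x)" "\<gamma>0 (- x)"] by (simp add: norm_character \<gamma>c \<gamma>0)
        show "- K \<in> sets \<nu>" using borel_compact[OF K(1)] by (simp add: sets)
        show "cmod (\<gamma> (- x) - \<gamma>0 (- x)) \<le> \<delta>" if "x \<notin> - K" for x using \<gamma> that by (auto intro: less_imp_le)
      qed (use \<delta> in simp)
      also have "\<dots> < e" using \<delta>(2) K(2) unfolding T_def by linarith
      also have "(\<integral>x. (\<gamma> (- x) - \<gamma>0 (- x)) * h x \<partial>\<nu>) = fourier_meas \<nu> h \<gamma> - fourier_meas \<nu> h \<gamma>0"
        unfolding fourier_meas_def left_diff_distrib
        by (intro Bochner_Integration.integral_diff integrable_fourier[OF sets h] \<gamma>c \<gamma>0)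
      finally show ?thesis .
    qed
    moreover have "openin dual_top ?N" by (rule openin_dual_top_basic[OF cK \<gamma>0 \<delta>(1)])
    moreover have "\<gamma>0 \<in> ?N" using \<gamma>0 \<delta> by simp
    ultimately show ?thesis by blast
  qed
  show ?thesis
    unfolding continuous_map_def
  proof (intro conjI allI impI)
    fix U :: "complex set" assume "openin euclidean U"
    then have U: "open U" by simp
    show "openin dual_top {\<gamma> \<in> topspace dual_top. fourier_meas \<nu> h \<gamma> \<in> U}"
    proof (subst openin_subopen, intro ballI)
      fix \<gamma>0 assume "\<gamma>0 \<in> {\<gamma> \<in> topspace dual_top. fourier_meas \<nu> h \<gamma> \<in> U}"
      then have \<gamma>0: "\<gamma>0 \<in> characters" "fourier_meas \<nu> h \<gamma>0 \<in> U" by (auto simp: topspace_dual_top)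
      obtain e where e: "e > 0" "\<forall>y. dist y (fourier_meas \<nu> h \<gamma>0) < e \<longrightarrow> y \<in> U"
        using U \<gamma>0(2) unfolding open_dist by blast
      obtain N where N: "openin dual_top N" "\<gamma>0 \<in> N" "\<forall>\<gamma>\<in>N. cmod (fourier_meas \<nu> h \<gamma> - fourier_meas \<nu> h \<gamma>0) < e"
        using near[OF \<gamma>0(1) e(1)] by blast
      show "\<exists>T. openin dual_top T \<and> \<gamma>0 \<in> T \<and> T \<subseteq> {\<gamma> \<in> topspace dual_top. fourier_meas \<nu> h \<gamma> \<in> U}"
        using N e(2) openin_subset[OF N(1)] by (intro exI[of _ N]) (auto simp: dist_norm)
    qed
  qed simp
qed


section \<open>Approximation by absolutely continuous measures\<close>

lemma norm_sum_fourier_meas_le: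
  fixes S :: "('g::topological_ab_group_add \<Rightarrow> complex) set"
  assumes sets: "sets M = sets borel" and h: "integrable M h" and S: "S \<subseteq> characters"
    and bd: "\<And>x. cmod (\<Sum>s\<in>S. c s * s x) \<le> B"
  shows "cmod (\<Sum>s\<in>S. c s * fourier_meas M h s) \<le> B * (\<integral>x. cmod (h x) \<partial>M)"
proof -
  have B: "0 \<le> B" using order_trans[OF norm_ge_zero bd] .
  have "cmod (\<integral>x. (\<Sum>s\<in>S. c s * s (- x)) * h x \<partial>M)
      \<le> B * (\<integral>x. cmod (h x) \<partial>M) + B * (\<integral>x. indicator {} x * cmod (h x) \<partial>M)"
  proof (rule integral_bounded_mult[OF h])
    show "(\<lambda>x. \<Sum>s\<in>S. c s * s (- x)) \<in> borel_measurable M"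
      using continuous_on_trig_poly_minus[OF S, of UNIV c 0]
      by (intro continuous_imp_measurable_borel_sets[OF sets]) simp
  qed (use B bd in auto)
  then show ?thesis by (simp add: sum_fourier_meas[OF sets h S])
qed

lemma integrable_complex_indicator:
  "A \<in> sets M \<Longrightarrow> emeasure M A < \<infinity> \<Longrightarrow> integrable M (indicator A :: 'a \<Rightarrow> complex)"
  using integrable_of_real[of M "indicator A", where 'a = complex] by (simp add: of_real_indicator)

text \<open>Both sides are the convolution of the polynomial with the indicator of \<open>A\<close>,
  evaluated at \<open>z\<close>.\<close>

lemma sum_fourier_indicator:
  fixes S :: "('g::{topological_ab_group_add, t2_space} \<Rightarrow> complex) set"
  assumes H: "haar_measure H" and A: "A \<in> sets H" "emeasure H A < \<infinity>" and S: "S \<subseteq> characters"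
  shows "(\<Sum>s\<in>S. c s * fourier_meas H (indicator A) s * s z)
    = (\<integral>x. (\<Sum>s\<in>S. c s * s (z - x)) * indicator A x \<partial>H)"
proof -
  have "(\<Sum>s\<in>S. c s * fourier_meas H (indicator A) s * s z)
      = (\<Sum>s\<in>S. (c s * s z) * fourier_meas H (indicator A) s)"
    by (simp add: mult_ac)
  also have "\<dots> = (\<integral>x. (\<Sum>s\<in>S. c s * s z * s (- x)) * indicator A x \<partial>H)"
    by (rule sum_fourier_meas[OF haar_sets[OF H] integrable_complex_indicator[OF A] S])
  also have "(\<lambda>x. \<Sum>s\<in>S. c s * s z * s (- x)) = (\<lambda>x. \<Sum>s\<in>S. c s * s (z - x))"
  proof (intro ext sum.cong refl)
    fix x s assume "s \<in> S"
    then show "c s * s z * s (- x) = c s * s (z - x)"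
      using S character_add[of s z "- x"] by auto
  qed
  finally show ?thesis .
qed

lemma integral_abs_indicator_translates:
  fixes H :: "'g::{topological_ab_group_add, t2_space} measure"
  assumes H: "haar_measure H" and A: "A \<in> sets H"
  shows "(\<integral>u. \<bar>indicator A (z + u) - indicator A (w + u)\<bar> \<partial>H) = translation_osc H A (w - z)"
proof -
  have m: "(\<lambda>u. indicator A (a + u) :: real) \<in> borel_measurable H" for a
    by (rule measurable_compose[OF haar_measurable_add[OF H]]) (use A in simp)
  have "(\<lambda>u. \<bar>indicator A (z + u) - indicator A (w + u)\<bar> :: real) \<in> borel_measurable H"
    using m[of z] m[of w] by simp
  from haar_integral_translate[OF H this, of "- w"]
  show ?thesis unfolding translation_osc_def by (simp add: algebra_simps)
qed

lemma smoothed_trig_poly_bound: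
  fixes S :: "('g::{topological_ab_group_add, t2_space} \<Rightarrow> complex) set"
  assumes H: "haar_measure H" and A: "A \<in> sets H" "emeasure H A < \<infinity>" and S: "S \<subseteq> characters"
    and bd: "\<And>x. cmod (\<Sum>s\<in>S. c s * s x) \<le> 1"
  shows "cmod (\<Sum>s\<in>S. c s * fourier_meas H (indicator A) s * s z) \<le> measure H A"
proof -
  have "cmod (\<Sum>s\<in>S. (c s * s z) * fourier_meas H (indicator A) s)
      \<le> 1 * (\<integral>x. cmod (indicator A x) \<partial>H)"
  proof (rule norm_sum_fourier_meas_le[OF haar_sets[OF H] integrable_complex_indicator[OF A] S])
    fix x
    have "(\<Sum>s\<in>S. c s * s z * s x) = (\<Sum>s\<in>S. c s * s (z + x))"
      by (rule sum.cong) (use S in \<open>auto simp: character_add\<close>)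
    then show "cmod (\<Sum>s\<in>S. c s * s z * s x) \<le> 1" using bd by simp
  qed
  moreover have "(\<integral>x. cmod (indicator A x) \<partial>H) = measure H A"
  proof -
    have "(\<lambda>x. cmod (indicator A x)) = (indicator A :: 'g \<Rightarrow> real)"
      by (auto simp: fun_eq_iff split: split_indicator)
    then show ?thesis using A by (simp add: space_of_sets_borel[OF haar_sets[OF H]])
  qed
  ultimately show ?thesis by (simp add: mult_ac)
qed

text \<open>Substituting x = z + u moves the shift from the polynomial to the indicator. The modulus
  obtained depends on \<open>A\<close> alone, not on the frequencies.\<close>

lemma smoothed_trig_poly_oscillation:
  fixes S :: "('g::{topological_ab_group_add, t2_space} \<Rightarrow> complex) set"
  assumes H: "haar_measure H" and A: "A \<in> sets H" "emeasure H A < \<infinity>" and S: "S \<subseteq> characters"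
    and bd: "\<And>x. cmod (\<Sum>s\<in>S. c s * s x) \<le> 1"
  shows "cmod ((\<Sum>s\<in>S. c s * fourier_meas H (indicator A) s * s z)
    - (\<Sum>s\<in>S. c s * fourier_meas H (indicator A) s * s w)) \<le> translation_osc H A (w - z)"
proof -
  define P where "P x = (\<Sum>s\<in>S. c s * s x)" for x
  note sets = haar_sets[OF H]
  have Pm: "(\<lambda>x. P (a - x)) \<in> borel_measurable H" for a
    unfolding P_def by (rule continuous_imp_measurable_borel_sets[OF sets continuous_on_trig_poly_minus[OF S]])
  have Ai: "integrable H (indicator A :: 'g \<Rightarrow> complex)" by (rule integrable_complex_indicator[OF A])
  have Ai': "integrable H (\<lambda>u. indicator A (a + u) :: complex)" for a
    by (rule haar_integrable_translate[OF H Ai])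
  have PA: "integrable H (\<lambda>u. P (- u) * indicator A (a + u))" for a
    using Pm[of 0] bd by (intro integrable_bounded_mult[OF Ai', where B = 1]) (auto simp: P_def)
  have Q: "(\<Sum>s\<in>S. c s * fourier_meas H (indicator A) s * s z) = (\<integral>u. P (- u) * indicator A (z + u) \<partial>H)" for z
  proof -
    have "(\<lambda>x. P (z - x) * indicator A x) \<in> borel_measurable H"
      using Pm A by simp
    from haar_integral_translate[OF H this, of z] show ?thesis
      unfolding sum_fourier_indicator[OF H A S] P_def[symmetric] by simp
  qed
  have "cmod ((\<Sum>s\<in>S. c s * fourier_meas H (indicator A) s * s z)
      - (\<Sum>s\<in>S. c s * fourier_meas H (indicator A) s * s w))
      = cmod (\<integral>u. P (- u) * indicator A (z + u) - P (- u) * indicator A (w + u) \<partial>H)"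
    unfolding Q by (simp add: PA)
  also have "\<dots> \<le> (\<integral>u. cmod (P (- u) * indicator A (z + u) - P (- u) * indicator A (w + u)) \<partial>H)"
    by (rule integral_norm_bound)
  also have "\<dots> \<le> (\<integral>u. \<bar>indicator A (z + u) - indicator A (w + u)\<bar> \<partial>H)"
  proof (rule integral_mono)
    show "integrable H (\<lambda>u. cmod (P (- u) * indicator A (z + u) - P (- u) * indicator A (w + u)))"
      using PA by simp
    show "integrable H (\<lambda>u. \<bar>indicator A (z + u) - indicator A (w + u)\<bar> :: real)"
      using A by (intro integrable_abs Bochner_Integration.integrable_diff haar_integrable_translate[OF H]) auto
    show "cmod (P (- u) * indicator A (z + u) - P (- u) * indicator A (w + u))
      \<le> \<bar>indicator A (z + u) - indicator A (w + u)\<bar>" for u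
      using bd by (auto simp: P_def split: split_indicator)
  qed
  finally show ?thesis unfolding integral_abs_indicator_translates[OF H A(1)] .
qed

text \<open>The difference is the integral of P(z - t) - P(z) over t in \<open>A\<close>, so
  closeness for shifts from \<open>A\<close> is enough.\<close>

lemma smoothed_trig_poly_close:
  fixes S :: "('g::{topological_ab_group_add, t2_space} \<Rightarrow> complex) set"
  assumes H: "haar_measure H" and A: "A \<in> sets H" "emeasure H A < \<infinity>" and S: "S \<subseteq> characters"
    and close: "\<And>t. t \<in> A \<Longrightarrow> cmod ((\<Sum>s\<in>S. c s * s (z - t)) - (\<Sum>s\<in>S. c s * s z)) \<le> \<eta>"
    and bd: "\<And>x. cmod (\<Sum>s\<in>S. c s * s x) \<le> 1"
  shows "cmod ((\<Sum>s\<in>S. c s * fourier_meas H (indicator A) s * s z) - measure H A * (\<Sum>s\<in>S. c s * s z))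
    \<le> \<eta> * measure H A"
proof -
  define P where "P x = (\<Sum>s\<in>S. c s * s x)" for x
  note sets = haar_sets[OF H]
  have Pm: "(\<lambda>x. P (a - x)) \<in> borel_measurable H" for a
    unfolding P_def by (rule continuous_imp_measurable_borel_sets[OF sets continuous_on_trig_poly_minus[OF S]])
  have Ai: "integrable H (indicator A :: 'g \<Rightarrow> complex)" by (rule integrable_complex_indicator[OF A])
  have PA: "integrable H (\<lambda>t. P (z - t) * indicator A t)"
    using Pm bd by (intro integrable_bounded_mult[OF Ai, where B = 1]) (auto simp: P_def)
  have "(\<integral>t. indicator A t \<partial>H) = complex_of_real (measure H A)"
    using integral_of_real[of H "indicator A :: 'g \<Rightarrow> real", where 'a = complex] A
    by (simp add: of_real_indicator space_of_sets_borel[OF sets])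
  then have "(\<Sum>s\<in>S. c s * fourier_meas H (indicator A) s * s z) - measure H A * (\<Sum>s\<in>S. c s * s z)
     = (\<integral>t. P (z - t) * indicator A t - P z * indicator A t \<partial>H)"
    unfolding sum_fourier_indicator[OF H A S] P_def[symmetric] using PA Ai by simp
  then have "cmod ((\<Sum>s\<in>S. c s * fourier_meas H (indicator A) s * s z) - measure H A * (\<Sum>s\<in>S. c s * s z))
     \<le> (\<integral>t. cmod (P (z - t) * indicator A t - P z * indicator A t) \<partial>H)"
    by (simp only: integral_norm_bound)
  also have "\<dots> \<le> (\<integral>t. \<eta> * indicator A t \<partial>H)"
  proof (rule integral_mono)
    show "integrable H (\<lambda>t. cmod (P (z - t) * indicator A t - P z * indicator A t))"
      using PA Ai by simp
    show "integrable H (\<lambda>t. \<eta> * indicator A t)" using A by simp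
    show "cmod (P (z - t) * indicator A t - P z * indicator A t) \<le> \<eta> * indicator A t" for t
      using close[of t] by (auto simp: P_def split: split_indicator)
  qed
  also have "\<dots> = \<eta> * measure H A" using A by (simp add: space_of_sets_borel[OF sets])
  finally show ?thesis .
qed

lemma compact_borel_partition:
  fixes K U :: "'g::{topological_ab_group_add, t2_space} set"
  assumes "compact K" "open U" "0 \<in> U"
  obtains n :: nat and e :: "nat \<Rightarrow> 'g" and A :: "nat \<Rightarrow> 'g set" where
    "\<forall>i. A i \<in> sets borel" "disjoint_family A" "K = (\<Union>i<n. A i)" "\<forall>i<n. \<forall>y\<in>A i. y - e i \<in> U"
proof -
  obtain X where X: "finite X" "X \<subseteq> K" "\<forall>y\<in>K. \<exists>x\<in>X. y - x \<in> U"
    using compact_group_cover[OF assms] .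
  obtain n :: nat and e where e: "X = e ` {i. i < n}"
    using finite_imp_nat_seg_image_inj_on[OF X(1)] by blast
  define B where "B i = {y \<in> K. y - e i \<in> U}" for i
  have "open ((\<lambda>y. y - e i) -` U)" for i by (intro open_vimage assms continuous_intros)
  moreover have "B i = K \<inter> (\<lambda>y. y - e i) -` U" for i by (auto simp: B_def)
  ultimately have B: "B i \<in> sets borel" for i using borel_compact[OF assms(1)] by simp
  have K: "K = (\<Union>i<n. B i)"
    using X(3) e by (auto simp: B_def)
  show thesis
  proof (rule that)
    show "\<forall>i. disjointed B i \<in> sets borel" using B by (auto simp: disjointed_def)
    show "disjoint_family (disjointed B)" by (rule disjoint_family_disjointed)
    have "(\<Union>i<n. disjointed B i) = (\<Union>i<n. B i)"
      using finite_UN_disjointed_eq[of B n] by (simp add: lessThan_atLeast0)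
    with K show "K = (\<Union>i<n. disjointed B i)" by simp
    show "\<forall>i<n. \<forall>y\<in>disjointed B i. y - e i \<in> U" by (auto simp: disjointed_def B_def)
  qed
qed

text \<open>The \<open>L\<^sup>1\<close> approximant is the convolution of the normalised indicator of a small
  neighbourhood with a discretisation of \<open>h d\<nu>\<close>; discretising avoids Fubini's theorem, which is
  not available because \<open>H\<close> need not be \<open>\<sigma>\<close>-finite.\<close>

lemma fourier_discrete_approximation:
  fixes H :: "'g::{topological_ab_group_add, t2_space} measure"
  assumes H: "haar_measure H" and M: "in_M \<nu> h"
    and W: "W \<in> sets H" "emeasure H W < \<infinity>" and m: "measure H W > 0" and "\<epsilon> > 0"
  obtains f where "integrable H f"
    "\<forall>S c. S \<subseteq> characters \<longrightarrow> (\<forall>x. cmod (\<Sum>s\<in>S. c s * s x) \<le> 1) \<longrightarrow>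
       cmod ((\<Sum>s\<in>S. c s * fourier_meas H f s)
         - (\<Sum>s\<in>S. c s * (fourier_meas H (indicator W) s / measure H W) * fourier_meas \<nu> h s)) \<le> \<epsilon>"
proof -
  have h: "integrable \<nu> h" and sets\<nu>: "sets \<nu> = sets borel"
    using M by (auto simp: in_M_def finite_radon_def)
  note sets = haar_sets[OF H]
  define T where "T = (\<integral>x. cmod (h x) \<partial>\<nu>)"
  have T: "T \<ge> 0" by (simp add: T_def)
  define \<eta> where "\<eta> = \<epsilon> / (2 * (T + 1))"
  have \<eta>: "\<eta> > 0" "\<eta> * T \<le> \<epsilon> / 2" using T \<open>\<epsilon> > 0\<close> by (auto simp: \<eta>_def field_simps)
  obtain K where K: "compact K" "(\<integral>x. indicator (- K) x * cmod (h x) \<partial>\<nu>) < \<epsilon> / 4"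
    using in_M_tight[OF M, of "\<epsilon> / 4"] \<open>\<epsilon> > 0\<close> by auto
  obtain U where U: "open U" "0 \<in> U" "\<forall>t\<in>U. translation_osc H W t < \<eta> * measure H W"
    using translation_osc_small[OF H W, of "\<eta> * measure H W"] \<eta> m by auto
  have "open (uminus -` U)" "0 \<in> uminus -` U"
    using U by (auto intro!: open_vimage continuous_intros)
  then obtain n :: nat and e A where A: "\<forall>i. A i \<in> sets borel" "disjoint_family A" "K = (\<Union>i<n. A i)"
      "\<forall>i<n. \<forall>y\<in>A i. y - e i \<in> uminus -` U"
    by (rule compact_borel_partition[OF K(1)])
  define \<mu> where "\<mu> i = (\<integral>x. indicator (A i) x * h x \<partial>\<nu>)" for i
  \<comment> \<open>The convolution of the normalised indicator of \<open>W\<close> with point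
    masses \<open>\<mu> i\<close> at \<open>e i\<close>, where \<open>\<mu> i\<close> is the mass
    that the complex measure gives to the cell \<open>A i\<close>.\<close>
  define f where "f x = (\<Sum>i<n. (\<mu> i / measure H W) * indicator W (x - e i))" for x
  have Wi: "integrable H (\<lambda>x. indicator W (x - t) :: complex)" for t
    using haar_integrable_translate[OF H integrable_complex_indicator[OF W], of "- t"] by simp
  have f: "integrable H f"
    unfolding f_def by (intro Bochner_Integration.integrable_sum integrable_mult_right Wi)
  have ff: "fourier_meas H f s = (\<Sum>i<n. \<mu> i * s (- e i)) * (fourier_meas H (indicator W) s / measure H W)"
    if s: "s \<in> characters" for s
  proof -
    have "fourier_meas H f s = (\<integral>x. (\<Sum>i<n. (\<mu> i / measure H W) * (s (- x) * indicator W (x - e i))) \<partial>H)"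
      unfolding fourier_meas_def f_def
      by (intro Bochner_Integration.integral_cong refl) (simp add: sum_distrib_left mult_ac)
    also have "\<dots> = (\<Sum>i<n. \<integral>x. (\<mu> i / measure H W) * (s (- x) * indicator W (x - e i)) \<partial>H)"
      by (intro Bochner_Integration.integral_sum integrable_mult_right integrable_fourier[OF sets Wi s])
    also have "\<dots> = (\<Sum>i<n. (\<mu> i / measure H W) * fourier_meas H (\<lambda>x. indicator W (x - e i)) s)"
      by (simp add: fourier_meas_def)
    finally show ?thesis
      unfolding fourier_indicator_translate[OF H W(1) s] sum_distrib_right by (simp add: mult_ac)
  qed
  have "cmod ((\<Sum>s\<in>S. c s * fourier_meas H f s)
      - (\<Sum>s\<in>S. c s * (fourier_meas H (indicator W) s / measure H W) * fourier_meas \<nu> h s)) \<le> \<epsilon>"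
    if S: "S \<subseteq> characters" and bd: "\<forall>x. cmod (\<Sum>s\<in>S. c s * s x) \<le> 1" for S c
  proof -
    \<comment> \<open>\<open>Q\<close> is the given polynomial convolved with the normalised
      indicator. Pairing with the smoothed measure integrates \<open>Q (- x)\<close>; pairing with
      \<open>f\<close> integrates the step function equal to \<open>Q (- e i)\<close> on
      \<open>A i\<close>. Their difference is at most \<open>\<eta>\<close> on \<open>K\<close> and
      2 elsewhere.\<close>
    define d where "d s = c s * (fourier_meas H (indicator W) s / measure H W)" for s
    define Q where "Q z = (\<Sum>s\<in>S. d s * s z)" for z
    have Q: "Q z = (\<Sum>s\<in>S. c s * fourier_meas H (indicator W) s * s z) / measure H W" for z
      by (simp add: Q_def d_def sum_divide_distrib)
    have Qbd: "cmod (Q z) \<le> 1" for z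
      using smoothed_trig_poly_bound[OF H W S, of c z] bd m by (simp add: Q norm_divide divide_le_eq)
    have Qosc: "cmod (Q z - Q w) \<le> \<eta>" if "w - z \<in> U" for z w
    proof -
      have "Q z - Q w = ((\<Sum>s\<in>S. c s * fourier_meas H (indicator W) s * s z)
          - (\<Sum>s\<in>S. c s * fourier_meas H (indicator W) s * s w)) / measure H W"
        by (simp only: Q diff_divide_distrib)
      then have "cmod (Q z - Q w) = cmod ((\<Sum>s\<in>S. c s * fourier_meas H (indicator W) s * s z)
          - (\<Sum>s\<in>S. c s * fourier_meas H (indicator W) s * s w)) / measure H W"
        using m by (simp only: norm_divide) simp
      also have "\<dots> \<le> translation_osc H W (w - z) / measure H W"
        using bd m by (intro divide_right_mono smoothed_trig_poly_oscillation[OF H W S]) auto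
      also have "\<dots> \<le> \<eta>" using U(3) that m by (simp add: divide_le_eq less_imp_le)
      finally show ?thesis .
    qed
    let ?g = "\<lambda>x. (\<Sum>i<n. Q (- e i) * indicator (A i) x)"
    have Qm: "(\<lambda>x. Q (- x)) \<in> borel_measurable \<nu>"
      unfolding Q_def using continuous_on_trig_poly_minus[OF S, of UNIV d 0]
      by (intro continuous_imp_measurable_borel_sets[OF sets\<nu>]) simp
    have gm: "?g \<in> borel_measurable \<nu>"
      using A(1) sets\<nu> by (intro borel_measurable_sum borel_measurable_times borel_measurable_const borel_measurable_indicator) auto
    have g_in: "?g x = Q (- e i)" if "i < n" "x \<in> A i" for x i
    proof -
      have "x \<notin> A j" if "j \<noteq> i" for j
        using A(2) \<open>x \<in> A i\<close> that by (auto simp: disjoint_family_on_def)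
      then have "?g x = (\<Sum>j<n. if j = i then Q (- e i) else 0)"
        using that by (intro sum.cong) auto
      then show ?thesis using that by simp
    qed
    have g_out: "?g x = 0" if "x \<notin> K" for x
      using that A(3) by (intro sum.neutral) auto
    have gbd: "cmod (?g x) \<le> 1" for x
      using Qbd g_in g_out[of x] A(3) by (cases "x \<in> K") auto
    have hA: "integrable \<nu> (\<lambda>x. indicator (A i) x * h x)" for i
      using A(1) sets\<nu> by (intro integrable_bounded_mult[OF h, where B = 1]) (auto split: split_indicator)
    have "(\<Sum>s\<in>S. c s * fourier_meas H f s) = (\<Sum>s\<in>S. d s * (\<Sum>i<n. \<mu> i * s (- e i)))"
      by (rule sum.cong) (use S in \<open>auto simp: ff d_def\<close>)
    also have "\<dots> = (\<Sum>i<n. Q (- e i) * \<mu> i)"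
      unfolding Q_def sum_distrib_left sum_distrib_right
      by (subst sum.swap) (simp add: mult_ac)
    also have "\<dots> = (\<Sum>i<n. \<integral>x. Q (- e i) * (indicator (A i) x * h x) \<partial>\<nu>)"
      by (simp add: \<mu>_def)
    also have "\<dots> = (\<integral>x. (\<Sum>i<n. Q (- e i) * (indicator (A i) x * h x)) \<partial>\<nu>)"
      by (intro Bochner_Integration.integral_sum[symmetric] integrable_mult_right hA)
    also have "\<dots> = (\<integral>x. ?g x * h x \<partial>\<nu>)" by (simp only: sum_distrib_right mult.assoc)
    finally have 1: "(\<Sum>s\<in>S. c s * fourier_meas H f s) = (\<integral>x. ?g x * h x \<partial>\<nu>)" .
    have 2: "(\<Sum>s\<in>S. c s * (fourier_meas H (indicator W) s / measure H W) * fourier_meas \<nu> h s)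
      = (\<integral>x. Q (- x) * h x \<partial>\<nu>)"
      unfolding d_def[symmetric] Q_def by (rule sum_fourier_meas[OF sets\<nu> h S])
    have "cmod (\<integral>x. (?g x - Q (- x)) * h x \<partial>\<nu>)
       \<le> \<eta> * (\<integral>x. cmod (h x) \<partial>\<nu>) + 2 * (\<integral>x. indicator (- K) x * cmod (h x) \<partial>\<nu>)"
    proof (rule integral_bounded_mult[OF h])
      show "(\<lambda>x. ?g x - Q (- x)) \<in> borel_measurable \<nu>" using gm Qm by (rule borel_measurable_diff)
      show "cmod (?g x - Q (- x)) \<le> 2" for x
        using norm_triangle_ineq4[of "?g x" "Q (- x)"] gbd[of x] Qbd[of "- x"] by linarith
      show "- K \<in> sets \<nu>" using borel_compact[OF K(1)] by (simp add: sets\<nu>)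
      show "cmod (?g x - Q (- x)) \<le> \<eta>" if "x \<notin> - K" for x
      proof -
        from that have "x \<in> K" by simp
        then obtain i where i: "i < n" "x \<in> A i" unfolding A(3) by blast
        \<comment> \<open>The partition was made with the reflection of \<open>U\<close> because
          \<open>Q\<close> is evaluated at -x and at \<open>- e i\<close>, whose difference is
          \<open>- (x - e i)\<close>.\<close>
        have "- (x - e i) \<in> U" using A(4) i by auto
        then show ?thesis unfolding g_in[OF i] by (intro Qosc) simp
      qed
    qed (use \<eta> in simp)
    also have "\<dots> \<le> \<epsilon>" using \<eta>(2) K(2) unfolding T_def by linarith
    also have "(\<integral>x. (?g x - Q (- x)) * h x \<partial>\<nu>) = (\<integral>x. ?g x * h x \<partial>\<nu>) - (\<integral>x. Q (- x) * h x \<partial>\<nu>)"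
      unfolding left_diff_distrib
      by (intro Bochner_Integration.integral_diff integrable_bounded_mult[OF h gm gbd] integrable_bounded_mult[OF h Qm Qbd])
    finally show ?thesis unfolding 1 2 .
  qed
  with f that show thesis by blast
qed

text \<open>The order of choices avoids circularity: \<open>C\<close> depends only on the measure,
  \<open>E\<close> and \<open>\<epsilon>\<close>; then \<open>U\<close> and \<open>W\<close> are
  fitted to all frequencies in the translates of \<open>E\<close> by \<open>C\<close>;
  \<open>f\<close> comes last. Smoothing and discretisation may each cost \<open>\<epsilon>\<close>
  / 2.\<close>

lemma rajchman_L1_approximation:
  fixes H :: "'g::{topological_ab_group_add, t2_space} measure"
  assumes lc: "locally_compact_space (euclidean :: 'g topology)" and H: "haar_measure H"
    and M: "in_M \<nu> h" and decay: "dual_decay (fourier_meas \<nu> h)"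
    and E: "compactin dual_top E" and "\<epsilon> > 0"
  shows "\<exists>f. integrable H f \<and> (\<forall>\<gamma>\<in>characters. \<forall>(S, c)\<in>trig_unit_ball (dual_translate E \<gamma>).
    cmod (\<Sum>s\<in>S. c s * (fourier_meas H f s - fourier_meas \<nu> h s)) \<le> \<epsilon>)"
proof -
  have h: "integrable \<nu> h" and sets\<nu>: "sets \<nu> = sets borel"
    using M by (auto simp: in_M_def finite_radon_def)
  note sets = haar_sets[OF H]
  have Ec: "E \<subseteq> characters"
    using compactin_subset_topspace[OF E] by (simp add: topspace_dual_top)
  note Eeq = compactin_imp_equicontinuous[OF lc E]
  define T where "T = (\<integral>x. cmod (h x) \<partial>\<nu>)"
  have T: "T \<ge> 0" by (simp add: T_def)
  define \<eta> where "\<eta> = \<epsilon> / (2 * (T + 1))"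
  have \<eta>: "\<eta> > 0" "\<eta> * T \<le> \<epsilon> / 2" using T \<open>\<epsilon> > 0\<close> by (auto simp: \<eta>_def field_simps)
  obtain C where C: "compactin dual_top C" "\<forall>\<gamma>\<in>characters - C. \<forall>(S, c)\<in>trig_unit_ball E.
       cmod (\<Sum>s\<in>S. c s * fourier_meas \<nu> h (\<lambda>x. s x * \<gamma> x)) \<le> \<epsilon> / 4"
    using fourier_local_decay[OF M decay Eeq Ec, of "\<epsilon> / 4"] \<open>\<epsilon> > 0\<close> by auto
  have Cc: "C \<subseteq> characters"
    using compactin_subset_topspace[OF C(1)] by (simp add: topspace_dual_top)
  let ?F = "\<Union>\<gamma>\<in>C. dual_translate E \<gamma>"
  have Feq: "equicontinuous_at_zero ?F"
    by (rule equicontinuous_at_zero_mult[OF Eeq Ec compactin_imp_equicontinuous[OF lc C(1)]])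
  have Fc: "?F \<subseteq> characters" using dual_translate_subset[OF Ec] Cc by blast
  obtain U where U: "open U" "0 \<in> U"
    "\<forall>S c x y. S \<subseteq> ?F \<longrightarrow> (\<forall>y. cmod (\<Sum>s\<in>S. c s * s y) \<le> 1) \<longrightarrow> x \<in> U \<longrightarrow>
       cmod ((\<Sum>s\<in>S. c s * s (x + y)) - (\<Sum>s\<in>S. c s * s y)) \<le> \<eta>"
    using trig_poly_equicontinuous[OF Feq Fc \<eta>(1)] by blast
  have "\<exists>W. open W \<and> (\<exists>K. compact K \<and> (0::'g) \<in> W \<and> W \<subseteq> K)"
    using lc by (simp add: locally_compact_space_def)
  then obtain W0 K0 where W0: "open W0" "compact K0" "(0::'g) \<in> W0" "W0 \<subseteq> K0" by blast
  \<comment> \<open>Intersecting with \<open>W0\<close> makes the Haar measure finite; the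
    reflection of \<open>U\<close> is used because convolution evaluates polynomials at z -
    t.\<close>
  define W where "W = W0 \<inter> uminus -` U"
  have Wo: "open W" "0 \<in> W" unfolding W_def using W0 U by (auto intro!: open_vimage continuous_intros)
  have W: "W \<in> sets H" using Wo sets by simp
  have Wfin: "emeasure H W < \<infinity>"
  proof -
    have "emeasure H W \<le> emeasure H K0"
      using W0(4) borel_compact[OF W0(2)] sets by (intro emeasure_mono) (auto simp: W_def)
    also have "\<dots> < \<infinity>" using H W0(2) unfolding haar_measure_def by blast
    finally show ?thesis .
  qed
  have "emeasure H W > 0" using H Wo unfolding haar_measure_def by blast
  then have m: "measure H W > 0" using Wfin by (simp add: measure_def enn2real_positive_iff)
  obtain f where f: "integrable H f"
    "\<forall>S c. S \<subseteq> characters \<longrightarrow> (\<forall>x. cmod (\<Sum>s\<in>S. c s * s x) \<le> 1) \<longrightarrow>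
       cmod ((\<Sum>s\<in>S. c s * fourier_meas H f s)
         - (\<Sum>s\<in>S. c s * (fourier_meas H (indicator W) s / measure H W) * fourier_meas \<nu> h s)) \<le> \<epsilon> / 2"
    using fourier_discrete_approximation[OF H M W Wfin m, of "\<epsilon> / 2"] \<open>\<epsilon> > 0\<close> by auto
  have "cmod (\<Sum>s\<in>S. c s * (fourier_meas H f s - fourier_meas \<nu> h s)) \<le> \<epsilon>"
    if \<gamma>: "\<gamma> \<in> characters" and Sc: "(S, c) \<in> trig_unit_ball (dual_translate E \<gamma>)" for \<gamma> S c
  proof -
    have S: "finite S" "S \<subseteq> dual_translate E \<gamma>" and bd: "\<And>x. cmod (\<Sum>s\<in>S. c s * s x) \<le> 1"
      using Sc by (auto simp: trig_unit_ball_def)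
    have Sch: "S \<subseteq> characters" using S(2) dual_translate_subset[OF Ec \<gamma>] by blast
    define d where "d s = c s * (fourier_meas H (indicator W) s / measure H W)" for s
    have Q: "(\<Sum>s\<in>S. d s * s z) = (\<Sum>s\<in>S. c s * fourier_meas H (indicator W) s * s z) / measure H W" for z
      by (simp add: d_def sum_divide_distrib)
    have 1: "cmod ((\<Sum>s\<in>S. c s * fourier_meas H f s) - (\<Sum>s\<in>S. d s * fourier_meas \<nu> h s)) \<le> \<epsilon> / 2"
      using f(2) Sch bd unfolding d_def by blast
    have 2: "cmod ((\<Sum>s\<in>S. d s * fourier_meas \<nu> h s) - (\<Sum>s\<in>S. c s * fourier_meas \<nu> h s)) \<le> \<epsilon> / 2"
    proof (cases "\<gamma> \<in> C")
      case True
      have "cmod (\<Sum>s\<in>S. (d s - c s) * s z) \<le> \<eta>" for z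
      proof -
        have "cmod ((\<Sum>s\<in>S. c s * s (z - t)) - (\<Sum>s\<in>S. c s * s z)) \<le> \<eta>" if "t \<in> W" for t
        proof -
          have "- t \<in> U" using that by (simp add: W_def)
          moreover have "S \<subseteq> ?F" using S(2) True by blast
          ultimately have "cmod ((\<Sum>s\<in>S. c s * s (- t + z)) - (\<Sum>s\<in>S. c s * s z)) \<le> \<eta>"
            using U(3) bd by blast
          then show ?thesis by simp
        qed
        from smoothed_trig_poly_close[OF H W Wfin Sch this bd]
        have "cmod ((\<Sum>s\<in>S. c s * fourier_meas H (indicator W) s * s z) - measure H W * (\<Sum>s\<in>S. c s * s z)) \<le> \<eta> * measure H W"
          by blast
        moreover have "(\<Sum>s\<in>S. (d s - c s) * s z) = ((\<Sum>s\<in>S. c s * fourier_meas H (indicator W) s * s z) - measure H W * (\<Sum>s\<in>S. c s * s z)) / measure H W"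
          using m by (simp add: left_diff_distrib sum_subtractf Q diff_divide_distrib)
        ultimately show ?thesis using m by (simp add: norm_divide divide_le_eq)
      qed
      from norm_sum_fourier_meas_le[OF sets\<nu> h Sch this]
      have "cmod (\<Sum>s\<in>S. (d s - c s) * fourier_meas \<nu> h s) \<le> \<eta> * T" by (simp add: T_def)
      then show ?thesis using \<eta>(2) by (simp add: left_diff_distrib sum_subtractf)
    next
      case False
      \<comment> \<open>Smoothing changes coefficients but not the spectrum and does not increase
        the sup norm. Hence the original and the smoothed polynomial are both admissible tests over
        the same translate, and each contributes at most \<open>\<epsilon>\<close> / 4.\<close>
      have out: "cmod (\<Sum>s\<in>S. b s * fourier_meas \<nu> h s) \<le> \<epsilon> / 4"
        if b: "(S, b) \<in> trig_unit_ball (dual_translate E \<gamma>)" for b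
      proof -
        obtain S' b' where S': "(S', b') \<in> trig_unit_ball E"
          "\<And>\<phi>. (\<Sum>s\<in>S. b s * \<phi> s) = (\<Sum>s\<in>S'. b' s * \<phi> (\<lambda>x. s x * \<gamma> x))"
          using trig_unit_ball_translate[OF \<gamma> b] by blast
        show ?thesis unfolding S'(2) using C(2) \<gamma> False S'(1) by blast
      qed
      have "cmod (\<Sum>s\<in>S. d s * s z) \<le> 1" for z
        unfolding Q using smoothed_trig_poly_bound[OF H W Wfin Sch bd, of z] m
        by (simp add: norm_divide divide_le_eq)
      then have "(S, d) \<in> trig_unit_ball (dual_translate E \<gamma>)"
        using S by (simp add: trig_unit_ball_def)
      from out[OF this] out[OF Sc] show ?thesis
        using norm_triangle_ineq4[of "\<Sum>s\<in>S. d s * fourier_meas \<nu> h s" "\<Sum>s\<in>S. c s * fourier_meas \<nu> h s"]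
        by linarith
    qed
    have "(\<Sum>s\<in>S. c s * (fourier_meas H f s - fourier_meas \<nu> h s))
      = ((\<Sum>s\<in>S. c s * fourier_meas H f s) - (\<Sum>s\<in>S. d s * fourier_meas \<nu> h s))
      + ((\<Sum>s\<in>S. d s * fourier_meas \<nu> h s) - (\<Sum>s\<in>S. c s * fourier_meas \<nu> h s))"
      by (simp add: right_diff_distrib sum_subtractf)
    also have "cmod \<dots> \<le> \<epsilon> / 2 + \<epsilon> / 2"
      by (rule norm_triangle_mono[OF 1 2])
    finally show ?thesis by simp
  qed
  with f(1) show ?thesis by blast
qed

section \<open>Assembly of the two statements\<close>

lemma C0_dual_fourier_iff: "in_M \<nu> h \<Longrightarrow> C0_dual (fourier_meas \<nu> h) \<longleftrightarrow> dual_decay (fourier_meas \<nu> h)"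
  for \<nu> :: "'g::{topological_ab_group_add, t2_space} measure"
  unfolding C0_dual_def dual_decay_def by (simp add: continuous_map_fourier_meas)

text \<open>Closure in a normed completion is sequential, so membership of a measure in the closure
  of L^1 is expressed by a sequence converging in \<open>Vnorm\<close>. The measures involved may
  have different base measures \<open>H\<close> and \<open>\<nu>\<close>, so the norm is applied to
  the difference of their transforms.\<close>

theorem theorem3p4:
  fixes V :: "('g::{topological_ab_group_add, t2_space} \<Rightarrow> complex) set"
    and H :: "'g measure"
  assumes loc_compact: "locally_compact_space (euclidean :: 'g topology)"
    and non_discrete: "\<exists>x::'g. \<not> open {x}"
    and haar: "haar_measure H"
    and V_open: "openin dual_top V"
    and V_zero: "(\<lambda>x. 1) \<in> V"
    and V_cpt: "compactin dual_top (dual_top closure_of V)"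
  shows
    "(\<forall>\<nu> h. in_M \<nu> h \<and> \<not> (AE x in \<nu>. h x = 0) \<and> C0_dual (fourier_meas \<nu> h) \<longrightarrow>
        (\<forall>\<epsilon>>0. \<exists>\<Omega>. \<Omega> \<subseteq> characters \<and> compactin dual_top \<Omega> \<and>
            dual_top interior_of \<Omega> \<noteq> {} \<and>
            \<Omega> \<subseteq> dual_top closure_of (dual_top interior_of \<Omega>) \<and>
            (\<forall>\<gamma>\<in>characters - \<Omega>.
                Vnorm_at (dual_top closure_of V) (fourier_meas \<nu> h) \<gamma> \<le> \<epsilon>)))
     \<and>
     (\<forall>\<nu> h. in_M \<nu> h \<longrightarrow>
        (C0_dual (fourier_meas \<nu> h) \<longleftrightarrow>
         (\<exists>f :: nat \<Rightarrow> 'g \<Rightarrow> complex. (\<forall>n. integrable H (f n)) \<and>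
            (\<lambda>n. Vnorm (dual_top closure_of V)
                    (\<lambda>\<gamma>. fourier_meas H (f n) \<gamma> - fourier_meas \<nu> h \<gamma>)) \<longlonglongrightarrow> 0)))"
proof -
  let ?E = "dual_top closure_of V"
  have Ec: "?E \<subseteq> characters"
    using compactin_subset_topspace[OF V_cpt] by (simp add: topspace_dual_top)
  note Eeq = compactin_imp_equicontinuous[OF loc_compact V_cpt]
  have E1: "(\<lambda>x. 1) \<in> ?E"
    using closure_of_subset[OF openin_subset[OF V_open]] V_zero by blast
  note sets = haar_sets[OF haar]
  have part1: "\<exists>\<Omega>. \<Omega> \<subseteq> characters \<and> compactin dual_top \<Omega> \<and> dual_top interior_of \<Omega> \<noteq> {} \<and>
      \<Omega> \<subseteq> dual_top closure_of (dual_top interior_of \<Omega>) \<and>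
      (\<forall>\<gamma>\<in>characters - \<Omega>. Vnorm_at ?E (fourier_meas \<nu> h) \<gamma> \<le> \<epsilon>)"
    if M: "in_M \<nu> h" and C0: "C0_dual (fourier_meas \<nu> h)" and "\<epsilon> > 0"
    for \<nu> :: "'g measure" and h and \<epsilon> :: real
  proof -
    obtain C where C: "compactin dual_top C" "\<forall>\<gamma>\<in>characters - C. \<forall>(S, c)\<in>trig_unit_ball ?E.
       cmod (\<Sum>s\<in>S. c s * fourier_meas \<nu> h (\<lambda>x. s x * \<gamma> x)) \<le> \<epsilon>"
      using fourier_local_decay[OF M _ Eeq Ec \<open>\<epsilon> > 0\<close>] C0_dual_fourier_iff[OF M] C0 by blast
    obtain \<Omega> where \<Omega>: "C \<subseteq> \<Omega>" "compactin dual_top \<Omega>" "dual_top interior_of \<Omega> \<noteq> {}"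
      "\<Omega> \<subseteq> dual_top closure_of (dual_top interior_of \<Omega>)"
      using compactin_subset_regular_compact[OF V_open V_zero V_cpt C(1)] .
    have "Vnorm_at ?E (fourier_meas \<nu> h) \<gamma> \<le> \<epsilon>" if \<gamma>: "\<gamma> \<in> characters - \<Omega>" for \<gamma>
      unfolding Vnorm_at_def
    proof (rule loc_norm_le)
      fix S c assume "(S, c) \<in> trig_unit_ball (dual_translate ?E \<gamma>)"
      then obtain S' c' where S': "(S', c') \<in> trig_unit_ball ?E"
        "\<And>\<phi>. (\<Sum>s\<in>S. c s * \<phi> s) = (\<Sum>s\<in>S'. c' s * \<phi> (\<lambda>x. s x * \<gamma> x))"
        using trig_unit_ball_translate \<gamma> by blast
      show "cmod (\<Sum>s\<in>S. c s * fourier_meas \<nu> h s) \<le> \<epsilon>"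
        unfolding S'(2) using C(2) \<Omega>(1) \<gamma> S'(1) by blast
    qed
    moreover have "\<Omega> \<subseteq> characters"
      using compactin_subset_topspace[OF \<Omega>(2)] by (simp add: topspace_dual_top)
    ultimately show ?thesis using \<Omega> by blast
  qed
  have part2a: "\<exists>f :: nat \<Rightarrow> 'g \<Rightarrow> complex. (\<forall>n. integrable H (f n)) \<and>
      (\<lambda>n. Vnorm ?E (\<lambda>\<gamma>. fourier_meas H (f n) \<gamma> - fourier_meas \<nu> h \<gamma>)) \<longlonglongrightarrow> 0"
    if M: "in_M \<nu> h" and C0: "C0_dual (fourier_meas \<nu> h)" for \<nu> :: "'g measure" and h
  proof -
    have "\<forall>n. \<exists>f. integrable H f \<and> (\<forall>\<gamma>\<in>characters. \<forall>(S, c)\<in>trig_unit_ball (dual_translate ?E \<gamma>).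
      cmod (\<Sum>s\<in>S. c s * (fourier_meas H f s - fourier_meas \<nu> h s)) \<le> 1 / real (Suc n))"
      using C0 unfolding C0_dual_fourier_iff[OF M]
      by (intro allI rajchman_L1_approximation[OF loc_compact haar M _ V_cpt]) auto
    from choice[OF this] obtain f where f: "\<forall>n. integrable H (f n) \<and>
      (\<forall>\<gamma>\<in>characters. \<forall>(S, c)\<in>trig_unit_ball (dual_translate ?E \<gamma>).
      cmod (\<Sum>s\<in>S. c s * (fourier_meas H (f n) s - fourier_meas \<nu> h s)) \<le> 1 / real (Suc n))"
      by blast
    let ?v = "\<lambda>n. Vnorm ?E (\<lambda>\<gamma>. fourier_meas H (f n) \<gamma> - fourier_meas \<nu> h \<gamma>)"
    have v: "0 \<le> ?v n" "?v n \<le> 1 / real (Suc n)" for n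
      by (rule Vnorm_bounds[where B = "1 / real (Suc n)"]; use f in blast)+
    have "?v \<longlonglongrightarrow> 0"
    proof (rule tendsto_sandwich[OF _ _ tendsto_const])
      show "(\<lambda>n. 1 / real (Suc n)) \<longlonglongrightarrow> 0"
        using LIMSEQ_inverse_real_of_nat by (simp add: inverse_eq_divide)
    qed (use v in auto)
    with f show ?thesis by blast
  qed
  have part2b: "C0_dual (fourier_meas \<nu> h)"
    if M: "in_M \<nu> h" and f: "\<forall>n. integrable H (f n)"
      and lim: "(\<lambda>n. Vnorm ?E (\<lambda>\<gamma>. fourier_meas H (f n) \<gamma> - fourier_meas \<nu> h \<gamma>)) \<longlonglongrightarrow> 0"
    for \<nu> :: "'g measure" and h and f :: "nat \<Rightarrow> 'g \<Rightarrow> complex"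
    unfolding C0_dual_fourier_iff[OF M]
  proof (rule dual_decay_uniform_limit)
    fix e :: real assume "e > 0"
    have h: "integrable \<nu> h" and sets\<nu>: "sets \<nu> = sets borel"
      using M by (auto simp: in_M_def finite_radon_def)
    have "\<forall>\<^sub>F n in sequentially. Vnorm ?E (\<lambda>\<gamma>. fourier_meas H (f n) \<gamma> - fourier_meas \<nu> h \<gamma>) < e"
      using order_tendstoD(2)[OF lim \<open>e > 0\<close>] .
    then obtain n where n: "Vnorm ?E (\<lambda>\<gamma>. fourier_meas H (f n) \<gamma> - fourier_meas \<nu> h \<gamma>) < e"
      by (auto simp: eventually_sequentially)
    \<comment> \<open>The sum of the two total variations bounds every pairing, so that
      \<open>Vnorm\<close> is a genuine supremum before it is compared with values of the
      transforms.\<close>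
    let ?B = "(\<integral>x. cmod (f n x) \<partial>H) + (\<integral>x. cmod (h x) \<partial>\<nu>)"
    have bd: "cmod (\<Sum>s\<in>S. c s * (fourier_meas H (f n) s - fourier_meas \<nu> h s)) \<le> ?B"
      if \<gamma>: "\<gamma> \<in> characters" and Sc: "(S, c) \<in> trig_unit_ball (dual_translate ?E \<gamma>)" for \<gamma> S c
    proof -
      have S: "S \<subseteq> characters" and b: "\<And>x. cmod (\<Sum>s\<in>S. c s * s x) \<le> 1"
        using Sc dual_translate_subset[OF Ec \<gamma>] by (auto simp: trig_unit_ball_def)
      have "cmod (\<Sum>s\<in>S. c s * fourier_meas H (f n) s) \<le> (\<integral>x. cmod (f n x) \<partial>H)"
        using norm_sum_fourier_meas_le[OF sets f[rule_format] S b] by simp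
      moreover have "cmod (\<Sum>s\<in>S. c s * fourier_meas \<nu> h s) \<le> (\<integral>x. cmod (h x) \<partial>\<nu>)"
        using norm_sum_fourier_meas_le[OF sets\<nu> h S b] by simp
      moreover have "(\<Sum>s\<in>S. c s * (fourier_meas H (f n) s - fourier_meas \<nu> h s))
         = (\<Sum>s\<in>S. c s * fourier_meas H (f n) s) - (\<Sum>s\<in>S. c s * fourier_meas \<nu> h s)"
        by (simp add: right_diff_distrib sum_subtractf)
      ultimately show ?thesis
        using norm_triangle_ineq4[of "\<Sum>s\<in>S. c s * fourier_meas H (f n) s" "\<Sum>s\<in>S. c s * fourier_meas \<nu> h s"]
        by simp
    qed
    have "cmod (fourier_meas \<nu> h \<gamma> - fourier_meas H (f n) \<gamma>) < e" if "\<gamma> \<in> characters" for \<gamma>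
    proof -
      have "cmod (fourier_meas H (f n) \<gamma> - fourier_meas \<nu> h \<gamma>)
          \<le> Vnorm ?E (\<lambda>\<gamma>. fourier_meas H (f n) \<gamma> - fourier_meas \<nu> h \<gamma>)"
        by (rule Vnorm_bounds(3)[where B = ?B and \<gamma> = \<gamma>]) (use bd E1 that in auto)
      then show ?thesis using n by (simp add: norm_minus_commute)
    qed
    then show "\<exists>\<psi>. dual_decay \<psi> \<and> (\<forall>\<gamma>\<in>characters. cmod (fourier_meas \<nu> h \<gamma> - \<psi> \<gamma>) < e)"
      using riemann_lebesgue[OF haar f[rule_format]] by blast
  qed
  show ?thesis
    using part1 part2a part2b by blast
qed

end
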